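(* The sequent calculus $\mathsf{MLK}$ p-simulates the tableau system $\mathsf{OTAB}$ for minimal entailment: there is a polynomial-time algorithm which, given any $\mathsf{OTAB}$ tableau for a sequent $\Gamma\vdash_M\Delta$ in which every branch is closed or ignorable, outputs an $\mathsf{MLK}$-derivation of $\Gamma\vdash_M\Delta$ (in particular of size polynomial in the size of the tableau).
   Context: Propositional formulas are built from atoms with $\bot,\top,\neg,\vee,\wedge,\rightarrow$. Models are identified with sets of true atoms, ordered by inclusion. A minimal-entailment sequent $\Gamma\vdash_M\Delta$ ($\Gamma,\Delta$ finite sets of formulas) is true iff every inclusion-minimal model of $\bigwedge\Gamma$ satisfies $\bigvee\Delta$. A proof system for a language $L$ is a polynomial-time computable partial function $f$ onto $L$; $f$ p-simulates $g$ if $g$-proofs can be transformed in polynomial time into $f$-proofs of the same string. $\mathsf{LK}$ is Gentzen's propositional sequent calculus on sequents $\Gamma\vdash\Delta$ of finite sets (axioms $A\vdash A$, $\bot\vdash$, $\vdash\top$; weakening on both sides; the standard left/right rules for $\neg,\wedge,\vee,\rightarrow$; and cut). $\mathsf{MLK}$ (Olivetti) consists of all $\mathsf{LK}$ axioms and rules together with: the axiom $\Gamma\vdash_M\neg p$ for every atom $p$ that does not occur positively in any formula of $\Gamma$ (an occurrence is positive if it lies in the scope of an even number of negations and antecedents of implications); the rule from $\Gamma\vdash\Delta$ infer $\Gamma\vdash_M\Delta$; M-cut: from $\Gamma\vdash_M\Sigma,A$ and $A,\Gamma\vdash_M\Lambda$ infer $\Gamma\vdash_M\Sigma,\Lambda$;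 from $\Gamma\vdash_M\Sigma$ and $\Gamma\vdash_M\Delta$ infer $\Gamma,\Sigma\vdash_M\Delta$; from $\Gamma\vdash_M\Sigma,A$ and $\Gamma\vdash_M\Sigma,B$ infer $\Gamma\vdash_M\Sigma,A\wedge B$; from $A,\Gamma\vdash_M\Sigma$ and $B,\Gamma\vdash_M\Sigma$ infer $A\vee B,\Gamma\vdash_M\Sigma$; from $\Gamma\vdash_M\Sigma,A$ infer $\Gamma\vdash_M\Sigma,B\vee A$ and $\Gamma\vdash_M\Sigma,A\vee B$; from $A,\Gamma\vdash_M\Sigma$ infer $\Gamma\vdash_M\Sigma,\neg A$; from $A,\Gamma\vdash_M\Sigma,B$ infer $\Gamma\vdash_M\Sigma,A\rightarrow B$. $\mathsf{OTAB}$ (Olivetti's tableau): nodes are labelled by signed formulas $T\phi$ or $F\phi$, and may be marked or unmarked. $\alpha$-type signed formulas (with components $\alpha_1,\alpha_2$): $T(A\wedge B)$: $TA,TB$; $F\neg(A\wedge B)$: $F\neg A,F\neg B$; $T\neg(A\vee B)$: $T\neg A,T\neg B$; $F(A\vee B)$: $FA,FB$; $T\neg(A\rightarrow B)$: $TA,T\neg B$; $F(A\rightarrow B)$: $F\neg A,FB$; $T\neg\neg A$: $TA,TA$; $F\neg\neg A$: $FA,FA$. $\beta$-type (components $\beta_1,\beta_2$): $T(A\vee B)$: $TA,TB$; $F\neg(A\vee B)$: $F\neg A,F\neg B$; $T\neg(A\wedge B)$: $T\neg A,T\neg B$; $F(A\wedge B)$: $FA,FB$; $T(A\rightarrow B)$: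 $T\neg A,TB$; $F\neg(A\rightarrow B)$: $FA,F\neg B$. A tableau for $\Gamma\vdash_M\Delta$ starts as a single branch of unmarked nodes $T\gamma$ ($\gamma\in\Gamma$) and $F\delta$ ($\delta\in\Delta$), and is extended on a branch $\mathcal B$ by: (A) for an unmarked $\alpha$-type node on $\mathcal B$, mark it and append unmarked $\alpha_1,\alpha_2$ to $\mathcal B$; (B) for an unmarked $\beta$-type node on $\mathcal B$, mark it and split $\mathcal B$ into two branches, one extended by unmarked $\beta_1$, the other by unmarked $\beta_2$. A branch is completed if all its unmarked formulas are literals; it is closed if it contains $TA$ and $T\neg A$ ($T$-closed), or $FA$ and $F\neg A$ ($F$-closed), or $TA$ and $FA$ ($TF$-closed), for some $A$. $\mathrm{At}(\mathcal B)=\{p \text{ atom}: Tp \text{ is a node of } \mathcal B\}$. $\mathcal B$ is ignorable type-1 if it is completed and some atom $a$ has $F\neg a$ on $\mathcal B$ but $Ta$ not on $\mathcal B$; it is ignorable type-2 if some other branch $\mathcal B'$ of the tableau is completed, not $T$-closed, and $\mathrm{At}(\mathcal B')\subsetneq\mathrm{At}(\mathcal B)$. An $\mathsf{OTAB}$-proof of $\Gamma\vdash_M\Delta$ is a tableau for it in which every branch is closed or ignorable. *)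

theory Defs
  imports Main "HOL-Computational_Algebra.Polynomial"
begin

section \<open>Polynomial time\<close>

text \<open>
  Strings are represented by binary trees, and computation is by programs built from Backus-style
  functional forms (composition, construction, conditional, while) over
  the tree primitives. In \<open>run c x y t\<close>, program \<open>c\<close> maps \<open>x\<close> to \<open>y\<close> in time \<open>t\<close>. Every
  construct is charged the size of its argument at each activation, not just one unit. Hence the
  output is never larger than the running time (lemma \<open>run_output_size\<close>), repeated
  duplication is not free, and the running time agrees with that of a multitape Turing
  machine up to a polynomial.
\<close>

datatype data = Lf | Nd data data

fun dsize :: "data \<Rightarrow> nat" where
  "dsize Lf = 1"
| "dsize (Nd a b) = 1 + dsize a + dsize b"

fun dfst :: "data \<Rightarrow> data" where
  "dfst Lf = Lf"
| "dfst (Nd a b) = a"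

fun dsnd :: "data \<Rightarrow> data" where
  "dsnd Lf = Lf"
| "dsnd (Nd a b) = b"

datatype prog =
    Ident | Leaf | Hd | Tl | Eq
  | Comp prog prog
  | Fork prog prog
  | Cond prog prog prog
  | While prog prog

text \<open>\<open>Comp c d\<close> runs \<open>c\<close> first. \<open>Lf\<close> is the truth value false, every other tree is true.\<close>

inductive run :: "prog \<Rightarrow> data \<Rightarrow> data \<Rightarrow> nat \<Rightarrow> bool" where
  run_Ident: "run Ident x x (1 + dsize x)"
| run_Leaf: "run Leaf x Lf (1 + dsize x)"
| run_Hd: "run Hd x (dfst x) (1 + dsize x)"
| run_Tl: "run Tl x (dsnd x) (1 + dsize x)"
| run_Eq: "run Eq x (if dfst x = dsnd x then Nd Lf Lf else Lf) (1 + dsize x + dsize Lf)"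
| run_Comp: "run c x y s \<Longrightarrow> run d y z t \<Longrightarrow> run (Comp c d) x z (1 + dsize x + s + t)"
| run_Fork: "run c x y s \<Longrightarrow> run d x z t \<Longrightarrow> run (Fork c d) x (Nd y z) (1 + dsize x + s + t)"
| run_Cond_true: "run b x v r \<Longrightarrow> v \<noteq> Lf \<Longrightarrow> run c x y s
    \<Longrightarrow> run (Cond b c d) x y (1 + dsize x + r + s)"
| run_Cond_false: "run b x Lf r \<Longrightarrow> run d x y s \<Longrightarrow> run (Cond b c d) x y (1 + dsize x + r + s)"
| run_While_stop: "run b x Lf r \<Longrightarrow> run (While b c) x x (1 + dsize x + r)"
| run_While_step: "run b x v r \<Longrightarrow> v \<noteq> Lf \<Longrightarrow> run c x y s \<Longrightarrow> run (While b c) y z t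
    \<Longrightarrow> run (While b c) x z (1 + dsize x + r + s + t)"

lemma dsize_pos: "1 \<le> dsize x"
  by (cases x) auto

lemma run_output_size: "run c x y t \<Longrightarrow> dsize y \<le> t"
proof (induction rule: run.induct)
  case (run_Hd x)
  show ?case by (cases x) auto
next
  case (run_Tl x)
  show ?case by (cases x) auto
next
  case (run_Eq x)
  show ?case using dsize_pos[of x] by auto
qed auto

lemma run_deterministic: "run c x y t \<Longrightarrow> run c x y' t' \<Longrightarrow> y' = y \<and> t' = t"
proof (induction arbitrary: y' t' rule: run.induct)
  case (run_Comp c x y s d z t)
  from run_Comp.prems show ?case by cases (use run_Comp.IH in blast)
next
  case (run_Fork c x y s d z t)
  from run_Fork.prems show ?case by cases (use run_Fork.IH in blast)
next
  case (run_Cond_true b x v r c y s d)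
  from run_Cond_true.prems show ?case by cases (use run_Cond_true.IH run_Cond_true.hyps in blast)+
next
  case (run_Cond_false b x r d y s c)
  from run_Cond_false.prems show ?case by cases (use run_Cond_false.IH in blast)+
next
  case (run_While_stop b x r c)
  from run_While_stop.prems show ?case by cases (use run_While_stop.IH in blast)+
next
  case (run_While_step b x v r c y s z t)
  from run_While_step.prems show ?case by cases (use run_While_step.IH run_While_step.hyps in blast)+
qed (auto elim: run.cases)

text \<open>
  A proof system is given by the graph of its partial function: \<open>f \<pi> \<phi>\<close> says that \<open>\<pi>\<close> is an
  \<open>f\<close>-proof of \<open>\<phi>\<close>.
\<close>

definition p_simulates :: "(data \<Rightarrow> data \<Rightarrow> bool) \<Rightarrow> (data \<Rightarrow> data \<Rightarrow> bool) \<Rightarrow> bool" where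
  "p_simulates f g \<longleftrightarrow>
     (\<exists>(c :: prog) (q :: nat poly). \<forall>\<pi> \<phi>. g \<pi> \<phi> \<longrightarrow>
        (\<exists>\<pi>' t. run c \<pi> \<pi>' t \<and> t \<le> poly q (dsize \<pi>) \<and> f \<pi>' \<phi>))"

section \<open>Formulas and sequents\<close>

text \<open>Atoms are named by bit strings, so the size of an atom is the length of its name.\<close>

type_synonym atom = "bool list"

datatype fm = Atom atom | Bot | Top | Neg fm | Con fm fm | Dis fm fm | Imp fm fm

text \<open>
  \<open>occurs True p A\<close> means that \<open>p\<close> has a positive occurrence in \<open>A\<close>, and
  \<open>occurs False p A\<close> that it has a negative one.
\<close>

primrec occurs :: "bool \<Rightarrow> atom \<Rightarrow> fm \<Rightarrow> bool" where
  "occurs b p (Atom q) \<longleftrightarrow> b \<and> q = p"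
| "occurs b p Bot \<longleftrightarrow> False"
| "occurs b p Top \<longleftrightarrow> False"
| "occurs b p (Neg A) \<longleftrightarrow> occurs (\<not> b) p A"
| "occurs b p (Con A B) \<longleftrightarrow> occurs b p A \<or> occurs b p B"
| "occurs b p (Dis A B) \<longleftrightarrow> occurs b p A \<or> occurs b p B"
| "occurs b p (Imp A B) \<longleftrightarrow> occurs (\<not> b) p A \<or> occurs b p B"

text \<open>
  The inference rules act on sequents of sets. In derivations, which are data to be
  output, the sets are presented by lists.
\<close>

datatype 'c sequent =
    Classical 'c 'c  (infix "\<turnstile>" 50)
  | Minimal 'c 'c  (infix "\<turnstile>\<^sub>M" 50)

section \<open>The sequent calculus MLK\<close>

text \<open>\<open>lk X S\<close> and \<open>mlk X S\<close>: the sequent \<open>S\<close> follows by one inference from premises in \<open>X\<close>.\<close>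

inductive lk :: "fm set sequent set \<Rightarrow> fm set sequent \<Rightarrow> bool" for X where
  ax: "lk X ({A} \<turnstile> {A})"
| botL: "lk X ({Bot} \<turnstile> {})"
| topR: "lk X ({} \<turnstile> {Top})"
| weakL: "(\<Gamma> \<turnstile> \<Sigma>) \<in> X \<Longrightarrow> lk X (insert A \<Gamma> \<turnstile> \<Sigma>)"
| weakR: "(\<Gamma> \<turnstile> \<Sigma>) \<in> X \<Longrightarrow> lk X (\<Gamma> \<turnstile> insert A \<Sigma>)"
| negL: "(\<Gamma> \<turnstile> insert A \<Sigma>) \<in> X \<Longrightarrow> lk X (insert (Neg A) \<Gamma> \<turnstile> \<Sigma>)"
| negR: "(insert A \<Gamma> \<turnstile> \<Sigma>) \<in> X \<Longrightarrow> lk X (\<Gamma> \<turnstile> insert (Neg A) \<Sigma>)"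
| conL1: "(insert A \<Gamma> \<turnstile> \<Sigma>) \<in> X \<Longrightarrow> lk X (insert (Con A B) \<Gamma> \<turnstile> \<Sigma>)"
| conL2: "(insert A \<Gamma> \<turnstile> \<Sigma>) \<in> X \<Longrightarrow> lk X (insert (Con B A) \<Gamma> \<turnstile> \<Sigma>)"
| conR: "(\<Gamma> \<turnstile> insert A \<Sigma>) \<in> X \<Longrightarrow> (\<Gamma> \<turnstile> insert B \<Sigma>) \<in> X \<Longrightarrow> lk X (\<Gamma> \<turnstile> insert (Con A B) \<Sigma>)"
| disL: "(insert A \<Gamma> \<turnstile> \<Sigma>) \<in> X \<Longrightarrow> (insert B \<Gamma> \<turnstile> \<Sigma>) \<in> X \<Longrightarrow> lk X (insert (Dis A B) \<Gamma> \<turnstile> \<Sigma>)"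
| disR1: "(\<Gamma> \<turnstile> insert A \<Sigma>) \<in> X \<Longrightarrow> lk X (\<Gamma> \<turnstile> insert (Dis A B) \<Sigma>)"
| disR2: "(\<Gamma> \<turnstile> insert A \<Sigma>) \<in> X \<Longrightarrow> lk X (\<Gamma> \<turnstile> insert (Dis B A) \<Sigma>)"
| impL: "(\<Gamma> \<turnstile> insert A \<Sigma>) \<in> X \<Longrightarrow> (insert B \<Gamma> \<turnstile> \<Sigma>) \<in> X \<Longrightarrow> lk X (insert (Imp A B) \<Gamma> \<turnstile> \<Sigma>)"
| impR: "(insert A \<Gamma> \<turnstile> insert B \<Sigma>) \<in> X \<Longrightarrow> lk X (\<Gamma> \<turnstile> insert (Imp A B) \<Sigma>)"
| cut: "(\<Gamma> \<turnstile> insert A \<Sigma>) \<in> X \<Longrightarrow> (insert A \<Gamma> \<turnstile> \<Sigma>) \<in> X \<Longrightarrow> lk X (\<Gamma> \<turnstile> \<Sigma>)"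

text \<open>
  In \<open>M_left\<close> the formulas of \<open>\<Sigma>\<close> are read disjunctively in the premise and conjunctively in the
  conclusion. With \<open>single = False\<close> the set \<open>\<Sigma>\<close> is arbitrary, but the rule is then unsound if it
  has more than one element: from \<open>{p \<or> q} \<turnstile>\<^sub>M {p, q}\<close> and \<open>{p \<or> q} \<turnstile>\<^sub>M {\<not> p, \<not> q}\<close> it infers
  \<open>{p \<or> q, p, q} \<turnstile>\<^sub>M {\<not> p, \<not> q}\<close>. With \<open>single = True\<close> it is restricted to its sound instances
  where \<open>\<Sigma>\<close> is one formula. Lemma \<open>mlk_derivation_single\<close> says that the restricted derivations
  are also derivations in the other sense.
\<close>

inductive mlk :: "bool \<Rightarrow> fm set sequent set \<Rightarrow> fm set sequent \<Rightarrow> bool" for single X where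
  lk: "lk X S \<Longrightarrow> mlk single X S"
| M_ax: "(\<forall>A\<in>\<Gamma>. \<not> occurs True p A) \<Longrightarrow> mlk single X (\<Gamma> \<turnstile>\<^sub>M {Neg (Atom p)})"
| M_lk: "(\<Gamma> \<turnstile> \<Delta>) \<in> X \<Longrightarrow> mlk single X (\<Gamma> \<turnstile>\<^sub>M \<Delta>)"
| M_cut: "(\<Gamma> \<turnstile>\<^sub>M insert A \<Sigma>) \<in> X \<Longrightarrow> (insert A \<Gamma> \<turnstile>\<^sub>M \<Lambda>) \<in> X \<Longrightarrow> mlk single X (\<Gamma> \<turnstile>\<^sub>M \<Sigma> \<union> \<Lambda>)"
| M_left: "(\<Gamma> \<turnstile>\<^sub>M \<Sigma>) \<in> X \<Longrightarrow> (\<Gamma> \<turnstile>\<^sub>M \<Delta>) \<in> X \<Longrightarrow> (single \<longrightarrow> (\<exists>A. \<Sigma> = {A}))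
    \<Longrightarrow> mlk single X (\<Gamma> \<union> \<Sigma> \<turnstile>\<^sub>M \<Delta>)"
| M_conR: "(\<Gamma> \<turnstile>\<^sub>M insert A \<Sigma>) \<in> X \<Longrightarrow> (\<Gamma> \<turnstile>\<^sub>M insert B \<Sigma>) \<in> X
    \<Longrightarrow> mlk single X (\<Gamma> \<turnstile>\<^sub>M insert (Con A B) \<Sigma>)"
| M_disL: "(insert A \<Gamma> \<turnstile>\<^sub>M \<Sigma>) \<in> X \<Longrightarrow> (insert B \<Gamma> \<turnstile>\<^sub>M \<Sigma>) \<in> X
    \<Longrightarrow> mlk single X (insert (Dis A B) \<Gamma> \<turnstile>\<^sub>M \<Sigma>)"
| M_disR1: "(\<Gamma> \<turnstile>\<^sub>M insert A \<Sigma>) \<in> X \<Longrightarrow> mlk single X (\<Gamma> \<turnstile>\<^sub>M insert (Dis B A) \<Sigma>)"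
| M_disR2: "(\<Gamma> \<turnstile>\<^sub>M insert A \<Sigma>) \<in> X \<Longrightarrow> mlk single X (\<Gamma> \<turnstile>\<^sub>M insert (Dis A B) \<Sigma>)"
| M_negR: "(insert A \<Gamma> \<turnstile>\<^sub>M \<Sigma>) \<in> X \<Longrightarrow> mlk single X (\<Gamma> \<turnstile>\<^sub>M insert (Neg A) \<Sigma>)"
| M_impR: "(insert A \<Gamma> \<turnstile>\<^sub>M insert B \<Sigma>) \<in> X \<Longrightarrow> mlk single X (\<Gamma> \<turnstile>\<^sub>M insert (Imp A B) \<Sigma>)"

definition mlk_derivation :: "bool \<Rightarrow> fm list sequent list \<Rightarrow> bool" where
  "mlk_derivation single d \<longleftrightarrow>
     (\<forall>i < length d. mlk single (map_sequent set ` set (take i d)) (map_sequent set (d ! i)))"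

lemma mlk_derivation_single: "mlk_derivation True d \<Longrightarrow> mlk_derivation single d"
proof -
  have "mlk True X S \<Longrightarrow> mlk single X S" for X S
    by (induction rule: mlk.induct) (blast intro: mlk.intros)+
  then show "mlk_derivation True d \<Longrightarrow> mlk_derivation single d"
    by (simp add: mlk_derivation_def)
qed

section \<open>The tableau system OTAB\<close>

datatype signed = T (form: fm) | F (form: fm)

inductive alpha :: "signed \<Rightarrow> signed \<Rightarrow> signed \<Rightarrow> bool" where
  "alpha (T (Con A B)) (T A) (T B)"
| "alpha (F (Neg (Con A B))) (F (Neg A)) (F (Neg B))"
| "alpha (T (Neg (Dis A B))) (T (Neg A)) (T (Neg B))"
| "alpha (F (Dis A B)) (F A) (F B)"
| "alpha (T (Neg (Imp A B))) (T A) (T (Neg B))"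
| "alpha (F (Imp A B)) (F (Neg A)) (F B)"
| "alpha (T (Neg (Neg A))) (T A) (T A)"
| "alpha (F (Neg (Neg A))) (F A) (F A)"

inductive beta :: "signed \<Rightarrow> signed \<Rightarrow> signed \<Rightarrow> bool" where
  "beta (T (Dis A B)) (T A) (T B)"
| "beta (F (Neg (Dis A B))) (F (Neg A)) (F (Neg B))"
| "beta (T (Neg (Con A B))) (T (Neg A)) (T (Neg B))"
| "beta (F (Con A B)) (F A) (F B)"
| "beta (T (Imp A B)) (T (Neg A)) (T B)"
| "beta (F (Neg (Imp A B))) (F A) (F (Neg B))"

text \<open>
  A branch is the list of its nodes from the root down; the Boolean of a node tells whether it is
  marked on this branch. Marks belong to branches: expanding a node on one branch must
  not mark it on another branch through the same node, on which its components have not been added.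
\<close>

type_synonym branch = "(signed \<times> bool) list"

text \<open>
  A tableau is the tree of extensions below its initial branch. The number \<open>i\<close> is the position on the
  current branch of the node being expanded; the signed formulas are the labels of the new nodes.
\<close>

datatype tableau =
    End
  | ExtA nat signed signed tableau
  | ExtB nat signed tableau signed tableau

definition expand :: "nat \<Rightarrow> signed list \<Rightarrow> branch \<Rightarrow> branch" where
  "expand i ss \<B> = \<B>[i := (fst (\<B> ! i), True)] @ map (\<lambda>s. (s, False)) ss"

primrec tableau_on :: "branch \<Rightarrow> tableau \<Rightarrow> bool" where
  "tableau_on \<B> End \<longleftrightarrow> True"
| "tableau_on \<B> (ExtA i s1 s2 t) \<longleftrightarrow>
     i < length \<B> \<and> \<not> snd (\<B> ! i) \<and> alpha (fst (\<B> ! i)) s1 s2 \<and>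
     tableau_on (expand i [s1, s2] \<B>) t"
| "tableau_on \<B> (ExtB i s1 t1 s2 t2) \<longleftrightarrow>
     i < length \<B> \<and> \<not> snd (\<B> ! i) \<and> beta (fst (\<B> ! i)) s1 s2 \<and>
     tableau_on (expand i [s1] \<B>) t1 \<and> tableau_on (expand i [s2] \<B>) t2"

primrec branches :: "branch \<Rightarrow> tableau \<Rightarrow> branch set" where
  "branches \<B> End = {\<B>}"
| "branches \<B> (ExtA i s1 s2 t) = branches (expand i [s1, s2] \<B>) t"
| "branches \<B> (ExtB i s1 t1 s2 t2) =
     branches (expand i [s1] \<B>) t1 \<union> branches (expand i [s2] \<B>) t2"

abbreviation labels :: "branch \<Rightarrow> signed set" where
  "labels \<B> \<equiv> fst ` set \<B>"

fun literal :: "fm \<Rightarrow> bool" where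
  "literal (Atom p) \<longleftrightarrow> True"
| "literal (Neg (Atom p)) \<longleftrightarrow> True"
| "literal _ \<longleftrightarrow> False"

definition completed :: "branch \<Rightarrow> bool" where
  "completed \<B> \<longleftrightarrow> (\<forall>(s, marked) \<in> set \<B>. \<not> marked \<longrightarrow> literal (form s))"

definition T_closed :: "branch \<Rightarrow> bool" where
  "T_closed \<B> \<longleftrightarrow> (\<exists>A. T A \<in> labels \<B> \<and> T (Neg A) \<in> labels \<B>)"

definition F_closed :: "branch \<Rightarrow> bool" where
  "F_closed \<B> \<longleftrightarrow> (\<exists>A. F A \<in> labels \<B> \<and> F (Neg A) \<in> labels \<B>)"

definition TF_closed :: "branch \<Rightarrow> bool" where
  "TF_closed \<B> \<longleftrightarrow> (\<exists>A. T A \<in> labels \<B> \<and> F A \<in> labels \<B>)"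

definition closed_branch :: "branch \<Rightarrow> bool" where
  "closed_branch \<B> \<longleftrightarrow> T_closed \<B> \<or> F_closed \<B> \<or> TF_closed \<B>"

definition At :: "branch \<Rightarrow> atom set" where
  "At \<B> = {p. T (Atom p) \<in> labels \<B>}"

definition ignorable1 :: "branch \<Rightarrow> bool" where
  "ignorable1 \<B> \<longleftrightarrow>
     completed \<B> \<and> (\<exists>a. F (Neg (Atom a)) \<in> labels \<B> \<and> T (Atom a) \<notin> labels \<B>)"

definition ignorable2 :: "branch set \<Rightarrow> branch \<Rightarrow> bool" where
  "ignorable2 \<BB> \<B> \<longleftrightarrow> (\<exists>\<B>'\<in>\<BB>. completed \<B>' \<and> \<not> T_closed \<B>' \<and> At \<B>' \<subset> At \<B>)"

definition initial_branch :: "fm list \<Rightarrow> fm list \<Rightarrow> branch" where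
  "initial_branch \<Gamma> \<Delta> = map (\<lambda>A. (T A, False)) \<Gamma> @ map (\<lambda>A. (F A, False)) \<Delta>"

definition otab_proof :: "fm list \<Rightarrow> fm list \<Rightarrow> tableau \<Rightarrow> bool" where
  "otab_proof \<Gamma> \<Delta> t \<longleftrightarrow>
     tableau_on (initial_branch \<Gamma> \<Delta>) t \<and>
     (\<forall>\<B> \<in> branches (initial_branch \<Gamma> \<Delta>) t.
        closed_branch \<B> \<or> ignorable1 \<B> \<or> ignorable2 (branches (initial_branch \<Gamma> \<Delta>) t) \<B>)"

section \<open>Encodings\<close>

text \<open>
  Constructor tags and positions on branches are in unary; a position is bounded by the length
  of the branch, so this affects sizes only polynomially.
\<close>

primrec enc_nat :: "nat \<Rightarrow> data" where
  "enc_nat 0 = Lf"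
| "enc_nat (Suc n) = Nd Lf (enc_nat n)"

primrec enc_bool :: "bool \<Rightarrow> data" where
  "enc_bool False = Lf"
| "enc_bool True = Nd Lf Lf"

primrec enc_list :: "('a \<Rightarrow> data) \<Rightarrow> 'a list \<Rightarrow> data" where
  "enc_list e [] = Lf"
| "enc_list e (x # xs) = Nd (e x) (enc_list e xs)"

primrec enc_fm :: "fm \<Rightarrow> data" where
  "enc_fm (Atom p) = Nd (enc_nat 0) (enc_list enc_bool p)"
| "enc_fm Bot = Nd (enc_nat 1) Lf"
| "enc_fm Top = Nd (enc_nat 2) Lf"
| "enc_fm (Neg A) = Nd (enc_nat 3) (enc_fm A)"
| "enc_fm (Con A B) = Nd (enc_nat 4) (Nd (enc_fm A) (enc_fm B))"
| "enc_fm (Dis A B) = Nd (enc_nat 5) (Nd (enc_fm A) (enc_fm B))"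
| "enc_fm (Imp A B) = Nd (enc_nat 6) (Nd (enc_fm A) (enc_fm B))"

primrec enc_sequent :: "fm list sequent \<Rightarrow> data" where
  "enc_sequent (\<Gamma> \<turnstile> \<Delta>) = Nd (enc_nat 0) (Nd (enc_list enc_fm \<Gamma>) (enc_list enc_fm \<Delta>))"
| "enc_sequent (\<Gamma> \<turnstile>\<^sub>M \<Delta>) = Nd (enc_nat 1) (Nd (enc_list enc_fm \<Gamma>) (enc_list enc_fm \<Delta>))"

primrec enc_signed :: "signed \<Rightarrow> data" where
  "enc_signed (T A) = Nd (enc_nat 0) (enc_fm A)"
| "enc_signed (F A) = Nd (enc_nat 1) (enc_fm A)"

primrec enc_tableau :: "tableau \<Rightarrow> data" where
  "enc_tableau End = Lf"
| "enc_tableau (ExtA i s1 s2 t) =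
     Nd (enc_nat 0) (Nd (enc_nat i) (Nd (enc_signed s1) (Nd (enc_signed s2) (enc_tableau t))))"
| "enc_tableau (ExtB i s1 t1 s2 t2) =
     Nd (enc_nat 1) (Nd (enc_nat i)
       (Nd (Nd (enc_signed s1) (enc_tableau t1)) (Nd (enc_signed s2) (enc_tableau t2))))"

lemma enc_nat_eq_iff [simp]: "enc_nat m = enc_nat n \<longleftrightarrow> m = n"
proof (induction m arbitrary: n)
  case 0
  show ?case by (cases n) auto
next
  case (Suc m)
  then show ?case by (cases n) auto
qed

lemma enc_bool_eq_iff [simp]: "enc_bool a = enc_bool b \<longleftrightarrow> a = b"
  by (cases a; cases b) auto

lemma enc_list_eq_iff:
  assumes "\<And>x y. e x = e y \<longleftrightarrow> x = y"
  shows "enc_list e xs = enc_list e ys \<longleftrightarrow> xs = ys"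
proof (induction xs arbitrary: ys)
  case Nil
  show ?case by (cases ys) auto
next
  case (Cons x xs)
  then show ?case by (cases ys) (auto simp: assms)
qed

lemma enc_fm_eq_iff [simp]: "enc_fm A = enc_fm B \<longleftrightarrow> A = B"
  by (induction A arbitrary: B; case_tac B)
     (auto simp: enc_list_eq_iff simp del: enc_nat.simps)

lemma enc_sequent_eq_iff [simp]: "enc_sequent S = enc_sequent S' \<longleftrightarrow> S = S'"
  by (cases S; cases S') (auto simp: enc_list_eq_iff simp del: enc_nat.simps)

lemma enc_signed_eq_iff [simp]: "enc_signed s = enc_signed s' \<longleftrightarrow> s = s'"
  by (cases s; cases s') (auto simp del: enc_nat.simps)

lemma enc_tableau_eq_iff [simp]: "enc_tableau t = enc_tableau t' \<longleftrightarrow> t = t'"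
  by (induction t arbitrary: t'; case_tac t') (auto simp del: enc_nat.simps)

definition OTAB :: "data \<Rightarrow> data \<Rightarrow> bool" where
  "OTAB \<pi> \<phi> \<longleftrightarrow>
     (\<exists>\<Gamma> \<Delta> t. \<pi> = Nd (enc_sequent (\<Gamma> \<turnstile>\<^sub>M \<Delta>)) (enc_tableau t) \<and> \<phi> = enc_sequent (\<Gamma> \<turnstile>\<^sub>M \<Delta>) \<and>
        otab_proof \<Gamma> \<Delta> t)"

definition MLK :: "bool \<Rightarrow> data \<Rightarrow> data \<Rightarrow> bool" where
  "MLK single \<pi> \<phi> \<longleftrightarrow>
     (\<exists>d \<Gamma> \<Delta>. \<pi> = enc_list enc_sequent d \<and> \<phi> = enc_sequent (\<Gamma> \<turnstile>\<^sub>M \<Delta>) \<and>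
        mlk_derivation single d \<and> d \<noteq> [] \<and> last d = (\<Gamma> \<turnstile>\<^sub>M \<Delta>))"

lemma OTAB_functional: "OTAB \<pi> \<phi> \<Longrightarrow> OTAB \<pi> \<phi>' \<Longrightarrow> \<phi> = \<phi>'"
  by (auto simp: OTAB_def)

lemma MLK_functional: "MLK single \<pi> \<phi> \<Longrightarrow> MLK single \<pi> \<phi>' \<Longrightarrow> \<phi> = \<phi>'"
  by (auto simp: MLK_def enc_list_eq_iff)

end

theory Submission
  imports Defs "HOL-Library.Sublist"
begin

text \<open>
  Let \<open>M\<close> be the set of atoms of a completed branch that is not \<open>T\<close>-closed. From \<open>M\<close> one derives
  minimally the negative literals of the branch (they do not occur in \<open>M\<close>), then all its true
  formulas from the leaf upwards, in particular \<open>\<Gamma>\<close>; hence \<open>M, \<Gamma> \<turnstile>\<^sub>M \<not> a\<close> for every atom \<open>a \<notin> M\<close>,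
  because \<open>M \<turnstile>\<^sub>M \<not> a\<close> is an axiom. Discharging \<open>M\<close> yields \<open>\<Gamma> \<turnstile>\<^sub>M D\<close> where \<open>D\<close> is \<open>M \<rightarrow> \<not> a\<close>.
  Ignorable branches of both types are closed classically by such formulas \<open>D\<close>: a branch of type 1
  by its own \<open>M\<close> and the atom \<open>a\<close> with \<open>F \<not> a\<close>, a branch of type 2 by the \<open>M\<close> of the smaller
  branch and an atom in the difference. So the tableau becomes a classical refutation, i.e. an
  \<open>LK\<close>-derivation of \<open>\<Gamma>, D\<^sub>1, \<dots>, D\<^sub>n \<turnstile> \<Delta>\<close>, and the \<open>D\<^sub>i\<close> are cut.

  To keep the algorithm simple, the derivation contains many useless sequents: instead of
  searching for the axiom that closes a branch, all known sequents are weakened by the formulas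
  of the branch.
\<close>

text \<open>The obstacle is that minimal entailment is not monotone, so
  \<open>\<turnstile>\<^sub>M\<close> has no weakening on the left. Its substitute is
  \<open>M_left\<close> with a single formula: a consequence of the context may be added to the
  context, provided that everything still needed afterwards is rederived there. This is how \<Gamma>
  comes to stand beside the atoms of a model, and how the formulas D come to stand beside each other
  before they are cut. The formula D for M and a is valid because M is a model of \<Gamma>: a
  minimal model of \<Gamma> that includes M must be M itself, and a is not in M. Nothing is asked
  about how the branch of M is closed or ignored, so a type-2 branch may point to a branch that is
  itself ignorable, and no order among the branches has to be found. The other concern is running
  time. The pieces of the derivation are written with maps, filters, prefixes and suffixes, so that
  closure properties of polynomial time apply to them mechanically; only the recursion over the
  tableau needs a loop of its own.\<close>

class encodable =
  fixes enc :: "'a \<Rightarrow> data"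
  assumes enc_eq_iff [simp]: "enc x = enc y \<longleftrightarrow> x = y"

instantiation data :: encodable
begin
definition enc_data :: "data \<Rightarrow> data" where [simp]: "enc_data x = x"
instance by standard simp
end

instantiation nat :: encodable
begin
definition enc_nat_inst [simp]: "enc = enc_nat"
instance by standard simp
end

instantiation bool :: encodable
begin
definition enc_bool_inst [simp]: "enc = enc_bool"
instance by standard simp
end

instantiation list :: (encodable) encodable
begin
definition enc_list_inst [simp]: "enc = enc_list enc"
instance by standard (simp add: enc_list_eq_iff)
end

instantiation prod :: (encodable, encodable) encodable
begin
definition enc_prod_inst [simp]: "enc p = Nd (enc (fst p)) (enc (snd p))"
instance by standard (auto simp: prod_eq_iff)
end

instantiation fm :: encodable
begin
definition enc_fm_inst [simp]: "enc = enc_fm"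
instance by standard simp
end

instantiation signed :: encodable
begin
definition enc_signed_inst [simp]: "enc = enc_signed"
instance by standard simp
end

instantiation tableau :: encodable
begin
definition enc_tableau_inst [simp]: "enc = enc_tableau"
instance by standard simp
end


section \<open>Functions computable in polynomial time\<close>

abbreviation esize :: "'a::encodable \<Rightarrow> nat" where
  "esize x \<equiv> dsize (enc x)"

text \<open>Coefficients are natural numbers, so no sign can spoil monotonicity; size bounds may
  therefore be substituted into time bounds.\<close>

lemma poly_nat_mono:
  fixes q :: "nat poly"
  shows "m \<le> n \<Longrightarrow> poly q m \<le> poly q n"
  by (induction q) (auto intro!: add_mono mult_mono)

definition poly_bounded :: "('a::encodable \<Rightarrow> nat) \<Rightarrow> bool" where
  "poly_bounded g \<longleftrightarrow> (\<exists>q :: nat poly. \<forall>x. g x \<le> poly q (esize x))"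

lemma poly_bounded_le: "poly_bounded h \<Longrightarrow> (\<And>x. g x \<le> h x) \<Longrightarrow> poly_bounded g"
  unfolding poly_bounded_def by (meson le_trans)

lemma poly_bounded_const: "poly_bounded (\<lambda>x. k)"
  unfolding poly_bounded_def by (rule exI[of _ "[:k:]"]) simp

lemma poly_bounded_esize: "poly_bounded esize"
  unfolding poly_bounded_def by (rule exI[of _ "[:0, 1:]"]) simp

lemma poly_bounded_add: "poly_bounded g \<Longrightarrow> poly_bounded h \<Longrightarrow> poly_bounded (\<lambda>x. g x + h x)"
  unfolding poly_bounded_def by (metis add_mono poly_add)

lemma poly_bounded_mult: "poly_bounded g \<Longrightarrow> poly_bounded h \<Longrightarrow> poly_bounded (\<lambda>x. g x * h x)"
  unfolding poly_bounded_def by (metis mult_mono poly_mult zero_le)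

lemma poly_bounded_Suc: "poly_bounded g \<Longrightarrow> poly_bounded (\<lambda>x. Suc (g x))"
  using poly_bounded_add[OF _ poly_bounded_const[of 1]] by simp

lemma poly_bounded_poly:
  assumes "poly_bounded g"
  shows "poly_bounded (\<lambda>x. poly q (g x))"
proof -
  obtain p where p: "g x \<le> poly p (esize x)" for x
    using assms unfolding poly_bounded_def by blast
  have "poly q (g x) \<le> poly (pcompose q p) (esize x)" for x
    using poly_nat_mono[OF p] by (simp add: poly_pcompose)
  then show ?thesis unfolding poly_bounded_def by blast
qed

lemma poly_bounded_comp:
  assumes "poly_bounded g" "poly_bounded (\<lambda>x. esize (f x))"
  shows "poly_bounded (\<lambda>x. g (f x))"
proof -
  obtain q where "g y \<le> poly q (esize y)" for y
    using assms(1) unfolding poly_bounded_def by blast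
  then show ?thesis
    by (rule poly_bounded_le[OF poly_bounded_poly[OF assms(2)]])
qed

lemmas poly_bounded_intros =
  poly_bounded_const poly_bounded_esize poly_bounded_add poly_bounded_mult poly_bounded_Suc

text \<open>The time bound may be any polynomially bounded function of the value, so bounds can be
  kept in the form in which they arise. The program is constrained on encodings of values of the
  argument type only.\<close>

definition polytime :: "('a::encodable \<Rightarrow> 'b::encodable) \<Rightarrow> bool" where
  "polytime f \<longleftrightarrow> (\<exists>c \<tau>. poly_bounded \<tau> \<and> (\<forall>x. \<exists>t \<le> \<tau> x. run c (enc x) (enc (f x)) t))"

lemma polytimeI:
  assumes "\<And>x. \<exists>t \<le> \<tau> x. run c (enc x) (enc (f x)) t" "poly_bounded \<tau>"
  shows "polytime f"
  using assms unfolding polytime_def by blast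

lemma polytimeE:
  assumes "polytime f"
  obtains c \<tau> where "\<And>x. \<exists>t \<le> \<tau> x. run c (enc x) (enc (f x)) t" "poly_bounded \<tau>"
  using assms unfolding polytime_def by blast

text \<open>The result types of \<open>f\<close> and \<open>g\<close> may differ, since only the
  trees are compared. Thus a function into one type is computed as a function into another: a list
  cell as a pair, a constructor as a tagged tuple, a selector as a function into
  \<open>data\<close>.\<close>

lemma polytime_cong:
  assumes "polytime f" "\<And>x. enc (f x) = enc (g x)"
  shows "polytime g"
  using assms unfolding polytime_def by simp

text \<open>Output is no larger than running time, by \<open>run_output_size\<close>. This controls
  the intermediate value in a composition.\<close>

lemma polytime_esize:
  assumes "polytime f"
  shows "poly_bounded (\<lambda>x. esize (f x))"
proof -
  obtain c \<tau> where "\<And>x. \<exists>t \<le> \<tau> x. run c (enc x) (enc (f x)) t" "poly_bounded \<tau>"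
    using assms by (rule polytimeE) blast
  then show ?thesis by (meson poly_bounded_le run_output_size le_trans)
qed

named_theorems polytime_intros

lemma polytime_ident [polytime_intros]: "polytime (\<lambda>x. x)"
proof (rule polytimeI)
  show "\<exists>t \<le> 1 + esize x. run Ident (enc x) (enc x) t" for x :: 'a
    using run_Ident by blast
qed (intro poly_bounded_intros)

text \<open>The program is a copy of the tree, with \<open>Fork\<close> at inner nodes and
  \<open>Leaf\<close> at leaves. Each of them is charged the whole input, which makes the time
  linear with a factor that depends on the constant.\<close>

lemma run_const: "\<exists>c k. \<forall>x. \<exists>t \<le> k + k * dsize x. run c x d t"
proof (induction d)
  case Lf
  have "\<exists>t \<le> 1 + 1 * dsize x. run Leaf x Lf t" for x
    using run_Leaf by fastforce
  then show ?case by blast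
next
  case (Nd d e)
  obtain c k where c: "\<And>x. \<exists>t \<le> k + k * dsize x. run c x d t" using Nd.IH(1) by blast
  obtain c' k' where c': "\<And>x. \<exists>t \<le> k' + k' * dsize x. run c' x e t" using Nd.IH(2) by blast
  have "\<exists>t \<le> (1 + k + k') + (1 + k + k') * dsize x. run (Fork c c') x (Nd d e) t" for x
  proof -
    obtain s t where "s \<le> k + k * dsize x" "run c x d s" "t \<le> k' + k' * dsize x" "run c' x e t"
      using c c' by blast
    then show ?thesis
      by (intro exI[of _ "1 + dsize x + s + t"] conjI run_Fork) (simp_all add: algebra_simps)
  qed
  then show ?case by blast
qed

lemma polytime_const [polytime_intros]: "polytime (\<lambda>x. k)"
proof -
  obtain c n where "\<And>x. \<exists>t \<le> n + n * dsize x. run c x (enc k) t"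
    using run_const by blast
  then show ?thesis
    by (rule polytimeI) (intro poly_bounded_intros)
qed

lemma polytime_comp:
  assumes "polytime g" "polytime f"
  shows "polytime (\<lambda>x. g (f x))"
proof -
  obtain c \<tau> where c: "\<And>x. \<exists>t \<le> \<tau> x. run c (enc x) (enc (f x)) t" "poly_bounded \<tau>"
    using assms(2) by (rule polytimeE) blast
  obtain d \<upsilon> where d: "\<And>x. \<exists>t \<le> \<upsilon> x. run d (enc x) (enc (g x)) t" "poly_bounded \<upsilon>"
    using assms(1) by (rule polytimeE) blast
  show ?thesis
  proof (rule polytimeI)
    fix x
    obtain s t where "s \<le> \<tau> x" "run c (enc x) (enc (f x)) s"
      "t \<le> \<upsilon> (f x)" "run d (enc (f x)) (enc (g (f x))) t"
      using c(1) d(1) by blast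
    then show "\<exists>t \<le> 1 + esize x + \<tau> x + \<upsilon> (f x). run (Comp c d) (enc x) (enc (g (f x))) t"
      by (intro exI[of _ "1 + esize x + s + t"] conjI run_Comp) simp_all
    show "poly_bounded (\<lambda>x. 1 + esize x + \<tau> x + \<upsilon> (f x))"
      by (intro poly_bounded_intros c(2) poly_bounded_comp[OF d(2) polytime_esize[OF assms(2)]])
  qed
qed

lemma polytime_Pair [polytime_intros]:
  assumes "polytime f" "polytime g"
  shows "polytime (\<lambda>x. (f x, g x))"
proof -
  obtain c \<tau> where c: "\<And>x. \<exists>t \<le> \<tau> x. run c (enc x) (enc (f x)) t" "poly_bounded \<tau>"
    using assms(1) by (rule polytimeE) blast
  obtain d \<upsilon> where d: "\<And>x. \<exists>t \<le> \<upsilon> x. run d (enc x) (enc (g x)) t" "poly_bounded \<upsilon>"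
    using assms(2) by (rule polytimeE) blast
  show ?thesis
  proof (rule polytimeI)
    fix x
    obtain s t where "s \<le> \<tau> x" "run c (enc x) (enc (f x)) s"
      "t \<le> \<upsilon> x" "run d (enc x) (enc (g x)) t"
      using c(1) d(1) by blast
    then show "\<exists>t \<le> 1 + esize x + \<tau> x + \<upsilon> x. run (Fork c d) (enc x) (enc (f x, g x)) t"
      using run_Fork[of c "enc x" "enc (f x)" s d "enc (g x)" t]
      by (intro exI[of _ "1 + esize x + s + t"]) auto
    show "poly_bounded (\<lambda>x. 1 + esize x + \<tau> x + \<upsilon> x)"
      by (intro poly_bounded_intros c(2) d(2))
  qed
qed

lemma polytime_comp2:
  assumes "polytime (\<lambda>z. h (fst z) (snd z))" "polytime f" "polytime g"
  shows "polytime (\<lambda>x. h (f x) (g x))"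
  using polytime_comp[OF assms(1) polytime_Pair[OF assms(2,3)]] by simp

lemma polytime_comp3:
  assumes "polytime (\<lambda>z. k (fst z) (fst (snd z)) (snd (snd z)))"
    "polytime f" "polytime g" "polytime h"
  shows "polytime (\<lambda>x. k (f x) (g x) (h x))"
  using polytime_comp[OF assms(1) polytime_Pair[OF assms(2) polytime_Pair[OF assms(3,4)]]] by simp

lemma polytime_run1:
  assumes "\<And>x. run c (enc x) (enc (f x)) (k + esize x)"
  shows "polytime f"
proof (rule polytimeI)
  show "\<exists>t \<le> k + esize x. run c (enc x) (enc (f x)) t" for x
    using assms by blast
qed (intro poly_bounded_intros)

lemma polytime_dfst: "polytime f \<Longrightarrow> polytime (\<lambda>x. dfst (enc (f x)))"
  by (rule polytime_comp[of "\<lambda>x. dfst (enc x)"], rule polytime_run1[where c = Hd and k = 1])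
     (simp only: enc_data_def run_Hd)

lemma polytime_dsnd: "polytime f \<Longrightarrow> polytime (\<lambda>x. dsnd (enc (f x)))"
  by (rule polytime_comp[of "\<lambda>x. dsnd (enc x)"], rule polytime_run1[where c = Tl and k = 1])
     (simp only: enc_data_def run_Tl)

lemma polytime_dfst_data: "polytime f \<Longrightarrow> polytime (\<lambda>x. dfst (f x))"
  using polytime_dfst[of f] by simp

lemma polytime_dsnd_data: "polytime f \<Longrightarrow> polytime (\<lambda>x. dsnd (f x))"
  using polytime_dsnd[of f] by simp

lemma polytime_enc: "polytime f \<Longrightarrow> polytime (\<lambda>x. enc (f x))"
  by (rule polytime_cong) auto

lemma polytime_fst [polytime_intros]: "polytime f \<Longrightarrow> polytime (\<lambda>x. fst (f x))"
  by (rule polytime_cong[OF polytime_dfst]) auto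

lemma polytime_snd [polytime_intros]: "polytime f \<Longrightarrow> polytime (\<lambda>x. snd (f x))"
  by (rule polytime_cong[OF polytime_dsnd]) auto

text \<open>The primitive \<open>Eq\<close> compares trees; it decides equality of values because
  encodings are injective.\<close>

lemma polytime_eq [polytime_intros]:
  assumes "polytime f" "polytime g"
  shows "polytime (\<lambda>x. f x = g x)"
proof -
  have "polytime (\<lambda>z :: 'b \<times> 'b. fst z = snd z)"
  proof (rule polytime_run1)
    show "run Eq (enc z) (enc (fst z = snd z)) (2 + esize z)" for z :: "'b \<times> 'b"
      using run_Eq[of "enc z"] by (cases "fst z = snd z") auto
  qed
  from polytime_comp2[OF this assms] show ?thesis .
qed

lemma polytime_If [polytime_intros]:
  assumes "polytime b" "polytime f" "polytime g"
  shows "polytime (\<lambda>x. if b x then f x else g x)"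
proof -
  obtain p \<sigma> where p: "\<And>x. \<exists>t \<le> \<sigma> x. run p (enc x) (enc (b x)) t" "poly_bounded \<sigma>"
    using assms(1) by (rule polytimeE) blast
  obtain c \<tau> where c: "\<And>x. \<exists>t \<le> \<tau> x. run c (enc x) (enc (f x)) t" "poly_bounded \<tau>"
    using assms(2) by (rule polytimeE) blast
  obtain d \<upsilon> where d: "\<And>x. \<exists>t \<le> \<upsilon> x. run d (enc x) (enc (g x)) t" "poly_bounded \<upsilon>"
    using assms(3) by (rule polytimeE) blast
  show ?thesis
  proof (rule polytimeI)
    fix x
    obtain r s t where r: "r \<le> \<sigma> x" "run p (enc x) (enc (b x)) r"
      and s: "s \<le> \<tau> x" "run c (enc x) (enc (f x)) s"
      and t: "t \<le> \<upsilon> x" "run d (enc x) (enc (g x)) t"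
      using p(1) c(1) d(1) by blast
    show "\<exists>t \<le> 1 + esize x + \<sigma> x + \<tau> x + \<upsilon> x.
        run (Cond p c d) (enc x) (enc (if b x then f x else g x)) t"
    proof (cases "b x")
      case True
      then show ?thesis using r s run_Cond_true[of p "enc x" "enc (b x)" r c "enc (f x)" s d]
        by (intro exI[of _ "1 + esize x + r + s"]) auto
    next
      case False
      then show ?thesis using r t run_Cond_false[of p "enc x" r d "enc (g x)" t c]
        by (intro exI[of _ "1 + esize x + r + t"]) auto
    qed
    show "poly_bounded (\<lambda>x. 1 + esize x + \<sigma> x + \<tau> x + \<upsilon> x)"
      by (intro poly_bounded_intros p(2) c(2) d(2))
  qed
qed

lemma polytime_not [polytime_intros]: "polytime b \<Longrightarrow> polytime (\<lambda>x. \<not> b x)"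
  by (rule polytime_cong[OF polytime_If[of b "\<lambda>_. False" "\<lambda>_. True"]])
     (auto intro: polytime_const)

lemma polytime_conj [polytime_intros]:
  "polytime b \<Longrightarrow> polytime c \<Longrightarrow> polytime (\<lambda>x. b x \<and> c x)"
  by (rule polytime_cong[OF polytime_If[of b c "\<lambda>_. False"]]) (auto intro: polytime_const)

lemma polytime_Cons [polytime_intros]:
  "polytime f \<Longrightarrow> polytime g \<Longrightarrow> polytime (\<lambda>x. f x # g x)"
  by (rule polytime_cong[OF polytime_Pair[of f g]]) auto

lemma polytime_tl [polytime_intros]: "polytime f \<Longrightarrow> polytime (\<lambda>x. tl (f x))"
  for f :: "'a::encodable \<Rightarrow> 'b::encodable list"
proof (rule polytime_cong[OF polytime_dsnd])
  show "enc (dsnd (enc (f x))) = enc (tl (f x))" for x by (cases "f x") auto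
qed

text \<open>The code of a list is its own truth value for nonemptiness, so it serves as the test.
  The continuation \<open>g\<close> needs the input together with head and tail, hence the
  triple.\<close>

lemma polytime_case_list [polytime_intros]:
  fixes l :: "'a::encodable \<Rightarrow> 'b::encodable list" and f :: "'a \<Rightarrow> 'c::encodable"
  assumes l: "polytime l" and "polytime f"
    and "polytime (\<lambda>z. g (fst z) (fst (snd z)) (snd (snd z)))"
  shows "polytime (\<lambda>x. case l x of [] \<Rightarrow> f x | y # ys \<Rightarrow> g x y ys)"
proof -
  \<comment> \<open>Head and tail are taken at type \<open>data\<close>: for the empty list they are
    leaves, which need not encode anything of the element type.\<close>
  have "polytime (\<lambda>x. (x, dfst (enc (l x)), dsnd (enc (l x))))"
    by (intro polytime_Pair polytime_ident polytime_dfst polytime_dsnd l)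
  then obtain b \<sigma> where b: "poly_bounded \<sigma>"
    "\<And>x. \<exists>t \<le> \<sigma> x. run b (enc x) (enc (x, dfst (enc (l x)), dsnd (enc (l x)))) t"
    by (rule polytimeE) blast
  obtain p \<rho> where p: "\<And>x. \<exists>t \<le> \<rho> x. run p (enc x) (enc (l x)) t" "poly_bounded \<rho>"
    using l by (rule polytimeE) blast
  obtain c \<tau> where c: "\<And>x. \<exists>t \<le> \<tau> x. run c (enc x) (enc (f x)) t" "poly_bounded \<tau>"
    using assms(2) by (rule polytimeE) blast
  obtain d \<upsilon> where d: "poly_bounded \<upsilon>"
    "\<And>z. \<exists>t \<le> \<upsilon> z. run d (enc z) (enc (g (fst z) (fst (snd z)) (snd (snd z)))) t"
    using assms(3) by (rule polytimeE) blast
  obtain q where q: "\<upsilon> z \<le> poly q (esize z)" for z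
    using d(1) unfolding poly_bounded_def by blast
  show ?thesis
  proof (rule polytimeI)
    fix x
    \<comment> \<open>The size of the triple is at most the time \<sigma> spent on building it, so
      applying \<open>q\<close> to \<sigma> bounds the time of the continuation.\<close>
    let ?B = "2 + 2 * esize x + \<rho> x + \<sigma> x + \<tau> x + poly q (\<sigma> x)"
    obtain r s t where r: "r \<le> \<rho> x" "run p (enc x) (enc (l x)) r"
      and s: "s \<le> \<tau> x" "run c (enc x) (enc (f x)) s"
      and t: "t \<le> \<sigma> x" "run b (enc x) (enc (x, dfst (enc (l x)), dsnd (enc (l x)))) t"
      using p(1) c(1) b(2) by blast
    show "\<exists>t \<le> ?B. run (Cond p (Comp b d) c) (enc x)
        (enc (case l x of [] \<Rightarrow> f x | y # ys \<Rightarrow> g x y ys)) t"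
    proof (cases "l x")
      case Nil
      then show ?thesis using r s run_Cond_false[of p "enc x" r c "enc (f x)" s "Comp b d"]
        by (intro exI[of _ "1 + esize x + r + s"]) auto
    next
      case (Cons y ys)
      have t': "run b (enc x) (enc (x, y, ys)) t" using t(2) Cons by simp
      obtain u where u: "u \<le> \<upsilon> (x, y, ys)" "run d (enc (x, y, ys)) (enc (g x y ys)) u"
        using d(2)[of "(x, y, ys)"] by auto
      have "esize (x, y, ys) \<le> \<sigma> x" using run_output_size[OF t'] t(1) by simp
      then have "u \<le> poly q (\<sigma> x)"
        using u(1) q[of "(x, y, ys)"] poly_nat_mono by (meson le_trans)
      moreover have "run (Cond p (Comp b d) c) (enc x) (enc (g x y ys))
          (1 + esize x + r + (1 + esize x + t + u))"
        using r(2) Cons by (intro run_Cond_true[where v = "enc (l x)"] run_Comp[OF t' u(2)]) auto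
      ultimately show ?thesis
        using r(1) t(1) Cons by (intro exI[of _ "1 + esize x + r + (1 + esize x + t + u)"]) auto
    qed
    show "poly_bounded (\<lambda>x. 2 + 2 * esize x + \<rho> x + \<sigma> x + \<tau> x + poly q (\<sigma> x))"
      by (intro poly_bounded_intros poly_bounded_poly b(1) p(2) c(2))
  qed
qed

section \<open>Loops\<close>

lemma run_While:
  assumes b: "\<And>s. \<exists>t \<le> \<sigma> s. run b (enc s) (enc (P s)) t"
    and c: "\<And>s. \<exists>t \<le> \<tau> s. run c (enc s) (enc (step s)) t"
    and "\<And>i. i < n \<Longrightarrow> P ((step ^^ i) s)" "\<not> P ((step ^^ n) s)"
    and "\<And>i. i \<le> n \<Longrightarrow> esize ((step ^^ i) s) + \<sigma> ((step ^^ i) s) + \<tau> ((step ^^ i) s) \<le> M"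
  shows "\<exists>t \<le> Suc n * Suc M. run (While b c) (enc s) (enc ((step ^^ n) s)) t"
  using assms(3-5)
proof (induction n arbitrary: s)
  case 0
  obtain t where t: "t \<le> \<sigma> s" "run b (enc s) (enc (P s)) t" using b by blast
  with 0 show ?case
    using 0(3)[of 0] run_While_stop[of b "enc s" t c]
    by (intro exI[of _ "1 + esize s + t"]) auto
next
  case (Suc n)
  have "\<exists>t \<le> Suc n * Suc M. run (While b c) (enc (step s)) (enc ((step ^^ n) (step s))) t"
  proof (rule Suc.IH)
    show "P ((step ^^ i) (step s))" if "i < n" for i
      using Suc.prems(1)[of "Suc i"] that by (simp add: funpow_swap1)
    show "\<not> P ((step ^^ n) (step s))" using Suc.prems(2) by (simp add: funpow_swap1)
    show "esize ((step ^^ i) (step s)) + \<sigma> ((step ^^ i) (step s)) + \<tau> ((step ^^ i) (step s)) \<le> M"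
      if "i \<le> n" for i
      using Suc.prems(3)[of "Suc i"] that by (simp add: funpow_swap1)
  qed
  then obtain u where u: "u \<le> Suc n * Suc M"
    "run (While b c) (enc (step s)) (enc ((step ^^ Suc n) s)) u"
    by (auto simp: funpow_swap1)
  obtain r t where r: "r \<le> \<sigma> s" "run b (enc s) (enc (P s)) r"
    and t: "t \<le> \<tau> s" "run c (enc s) (enc (step s)) t"
    using b c by blast
  have "1 + esize s + r + t + u \<le> Suc (Suc n) * Suc M"
    using u(1) r(1) t(1) Suc.prems(3)[of 0] by simp
  moreover have "P s" using Suc.prems(1)[of 0] by simp
  ultimately show ?case
    using r(2) t(2) u(2) run_While_step[of b "enc s" "enc (P s)" r c "enc (step s)" t]
    by (intro exI[of _ "1 + esize s + r + t + u"]) auto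
qed

text \<open>The number \<open>n\<close> of iterations belongs to the analysis; the program only runs
  the test. A bound \<open>g\<close> on all intermediate states must be supplied, because iterating
  a polynomial-time step can let the state grow exponentially.\<close>

lemma polytime_While:
  fixes init :: "'a::encodable \<Rightarrow> 's::encodable"
  assumes "polytime init" "polytime P" "polytime (step :: 's \<Rightarrow> 's)"
    and "poly_bounded n" "poly_bounded g"
    and "\<And>x i. i < n x \<Longrightarrow> P ((step ^^ i) (init x))" "\<And>x. \<not> P ((step ^^ n x) (init x))"
    and size: "\<And>x i. i \<le> n x \<Longrightarrow> esize ((step ^^ i) (init x)) \<le> g x"
  shows "polytime (\<lambda>x. (step ^^ n x) (init x))"
proof -
  obtain c \<tau> where c: "\<And>x. \<exists>t \<le> \<tau> x. run c (enc x) (enc (init x)) t" "poly_bounded \<tau>"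
    using assms(1) by (rule polytimeE) blast
  obtain p \<rho> where p: "\<And>s. \<exists>t \<le> \<rho> s. run p (enc s) (enc (P s)) t" "poly_bounded \<rho>"
    using assms(2) by (rule polytimeE) blast
  obtain d \<sigma> where d: "\<And>s. \<exists>t \<le> \<sigma> s. run d (enc s) (enc (step s)) t" "poly_bounded \<sigma>"
    using assms(3) by (rule polytimeE) blast
  obtain q q' where q: "\<And>s. \<rho> s \<le> poly q (esize s)" and q': "\<And>s. \<sigma> s \<le> poly q' (esize s)"
    using p(2) d(2) unfolding poly_bounded_def by blast
  let ?M = "\<lambda>x. g x + poly q (g x) + poly q' (g x)"
  show ?thesis
  proof (rule polytimeI)
    fix x
    have "\<exists>t \<le> Suc (n x) * Suc (?M x).
        run (While p d) (enc (init x)) (enc ((step ^^ n x) (init x))) t"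
    proof (rule run_While[where P = P and step = step])
      show "P ((step ^^ i) (init x))" if "i < n x" for i using that by (rule assms(6))
      show "\<not> P ((step ^^ n x) (init x))" by (rule assms(7))
      fix i assume i: "i \<le> n x"
      let ?s = "(step ^^ i) (init x)"
      show "esize ?s + \<rho> ?s + \<sigma> ?s \<le> ?M x"
        by (intro add_mono size[OF i] order.trans[OF q] order.trans[OF q'] poly_nat_mono)
    qed (rule p(1) d(1))+
    then obtain t where t: "t \<le> Suc (n x) * Suc (?M x)"
      "run (While p d) (enc (init x)) (enc ((step ^^ n x) (init x))) t" by blast
    obtain s where s: "s \<le> \<tau> x" "run c (enc x) (enc (init x)) s" using c(1) by blast
    show "\<exists>t \<le> 1 + esize x + \<tau> x + Suc (n x) * Suc (?M x).
        run (Comp c (While p d)) (enc x) (enc ((step ^^ n x) (init x))) t"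
      using s t by (intro exI[of _ "1 + esize x + s + t"] conjI run_Comp) simp_all
    show "poly_bounded (\<lambda>x. 1 + esize x + \<tau> x + Suc (n x) * Suc (?M x))"
      by (intro poly_bounded_intros poly_bounded_poly assms(4,5) c(2))
  qed
qed

section \<open>Lists\<close>

lemma length_le_esize: "length l \<le> esize l"
  by (induction l) auto

text \<open>The two codes merge at the closing leaf of the first list, which accounts for the
  \<open>Suc\<close>.\<close>

lemma esize_append: "Suc (esize (l @ m)) = esize l + esize m"
  by (induction l) auto

lemma esize_mem: "x \<in> set l \<Longrightarrow> esize x < esize l"
  by (induction l) auto

lemma esize_rev: "esize (rev l) = esize l"
proof (induction l)
  case (Cons x l)
  then show ?case using esize_append[of "rev l" "[x]"] by simp
qed simp

lemma esize_list_le: "(\<And>x. x \<in> set l \<Longrightarrow> esize x \<le> k) \<Longrightarrow> esize l \<le> Suc (length l * Suc k)"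
proof (induction l)
  case (Cons x l)
  have "esize x \<le> k" "esize l \<le> Suc (length l * Suc k)" using Cons by auto
  then show ?case by simp
qed simp

text \<open>The loop state consists of the input, the accumulator and the rest of the list; the
  input is carried along because \<open>g\<close> depends on it. As for loops in general, the
  accumulator must be bounded at every prefix of the list.\<close>

lemma polytime_foldl:
  fixes l :: "'a::encodable \<Rightarrow> 'b::encodable list" and a :: "'a \<Rightarrow> 'c::encodable"
  assumes l: "polytime l" and a: "polytime a"
    and g: "polytime (\<lambda>z. g (fst z) (fst (snd z)) (snd (snd z)))"
    and h: "poly_bounded h" "\<And>x ys zs. l x = ys @ zs \<Longrightarrow> esize (foldl (g x) (a x) ys) \<le> h x"
  shows "polytime (\<lambda>x. foldl (g x) (a x) (l x))"
proof -
  define init where "init = (\<lambda>x. ((x, a x), l x))"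
  define P where "P = (\<lambda>s :: ('a \<times> 'c) \<times> 'b list. snd s \<noteq> [])"
  define step where "step = (\<lambda>s :: ('a \<times> 'c) \<times> 'b list. case snd s of [] \<Rightarrow> s
    | y # ys \<Rightarrow> ((fst (fst s), g (fst (fst s)) (snd (fst s)) y), ys))"
  have it: "(step ^^ i) (init x) = ((x, foldl (g x) (a x) (take i (l x))), drop i (l x))"
    if "i \<le> length (l x)" for i x
    using that
  proof (induction i)
    case (Suc i)
    then have "drop i (l x) = l x ! i # drop (Suc i) (l x)" "i < length (l x)"
      by (auto simp: Cons_nth_drop_Suc)
    with Suc show ?case by (simp add: step_def take_Suc_conv_app_nth)
  qed (simp add: init_def)
  have "polytime (\<lambda>x. (step ^^ length (l x)) (init x))"
  proof (rule polytime_While)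
    show "polytime init" unfolding init_def by (intro polytime_intros l a)
    show "polytime P" unfolding P_def by (intro polytime_intros)
    show "polytime step" unfolding step_def
      by (intro polytime_intros polytime_comp3[OF g])
    show "poly_bounded (\<lambda>x. length (l x))"
      by (rule poly_bounded_le[OF polytime_esize[OF l] length_le_esize])
    show "poly_bounded (\<lambda>x. 2 + esize x + h x + esize (l x))"
      by (intro poly_bounded_intros h(1) polytime_esize[OF l])
    show "P ((step ^^ i) (init x))" if "i < length (l x)" for x i
      using that by (simp add: it P_def)
    show "\<not> P ((step ^^ length (l x)) (init x))" for x
      by (simp add: it P_def)
    show "esize ((step ^^ i) (init x)) \<le> 2 + esize x + h x + esize (l x)"
      if "i \<le> length (l x)" for x i
      using that h(2)[of x "take i (l x)" "drop i (l x)"]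
        esize_append[of "take i (l x)" "drop i (l x)"] dsize_pos[of "enc (take i (l x))"]
      by (simp add: it)
  qed
  then have "polytime (\<lambda>x. snd (fst ((step ^^ length (l x)) (init x))))"
    by (intro polytime_intros)
  then show ?thesis by (simp add: it)
qed

lemma polytime_rev [polytime_intros]:
  fixes l :: "'a::encodable \<Rightarrow> 'b::encodable list"
  assumes "polytime l"
  shows "polytime (\<lambda>x. rev (l x))"
proof -
  have eq: "foldl (\<lambda>acc y. y # acc) zs ys = rev ys @ zs" for zs ys :: "'b list"
    by (induction ys arbitrary: zs) auto
  have "polytime (\<lambda>x. foldl (\<lambda>acc y. y # acc) [] (l x))"
  proof (rule polytime_foldl)
    show "poly_bounded (\<lambda>x. esize (l x))" by (rule polytime_esize[OF assms])
    show "esize (foldl (\<lambda>acc y. y # acc) [] ys) \<le> esize (l x)" if "l x = ys @ zs" for x ys zs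
      using esize_append[of ys zs] dsize_pos[of "enc zs"] that esize_rev[of ys]
      unfolding eq by simp
  qed (intro polytime_intros assms)+
  then show ?thesis by (simp add: eq)
qed

lemma polytime_append [polytime_intros]:
  fixes l :: "'a::encodable \<Rightarrow> 'b::encodable list"
  assumes "polytime l" "polytime m"
  shows "polytime (\<lambda>x. l x @ m x)"
proof -
  have eq: "foldl (\<lambda>acc y. y # acc) zs ys = rev ys @ zs" for zs ys :: "'b list"
    by (induction ys arbitrary: zs) auto
  have "polytime (\<lambda>x. foldl (\<lambda>acc y. y # acc) (m x) (rev (l x)))"
  proof (rule polytime_foldl)
    show "poly_bounded (\<lambda>x. esize (l x) + esize (m x))"
      by (intro poly_bounded_intros polytime_esize assms)
    show "esize (foldl (\<lambda>acc y. y # acc) (m x) ys) \<le> esize (l x) + esize (m x)"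
      if "rev (l x) = ys @ zs" for x ys zs
      using esize_append[of ys zs] dsize_pos[of "enc zs"] that esize_append[of "rev ys" "m x"]
        esize_rev[of "l x"] esize_rev[of ys]
      unfolding eq by simp
  qed (intro polytime_intros assms)+
  then show ?thesis by (simp add: eq)
qed

text \<open>No growth condition is needed here: the blocks do not depend on each other, and each is
  polynomial in the size of the input and of one list element. Maps, filters and bounded quantifiers
  are special cases. The accumulator holds the result in reverse.\<close>

lemma polytime_concat_map [polytime_intros]:
  fixes l :: "'a::encodable \<Rightarrow> 'b::encodable list" and g :: "'a \<Rightarrow> 'b \<Rightarrow> 'c::encodable list"
  assumes l: "polytime l" and g: "polytime (\<lambda>z. g (fst z) (snd z))"
  shows "polytime (\<lambda>x. concat (map (g x) (l x)))"
proof -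
  have eq: "foldl (\<lambda>acc y. rev (g x y) @ acc) zs ys = rev (concat (map (g x) ys)) @ zs" for x zs ys
    by (induction ys arbitrary: zs) auto
  obtain q where q: "esize (g x y) \<le> poly q (esize (x, y))" for x y
    using polytime_esize[OF g] unfolding poly_bounded_def by auto
  have "polytime (\<lambda>x. rev (foldl (\<lambda>acc y. rev (g x y) @ acc) [] (l x)))"
  proof (rule polytime_rev, rule polytime_foldl)
    let ?h = "\<lambda>x. 1 + esize (l x) * poly q (1 + esize x + esize (l x))"
    show "poly_bounded ?h"
      by (intro poly_bounded_intros poly_bounded_poly polytime_esize[OF l])
    show "esize (foldl (\<lambda>acc y. rev (g x y) @ acc) [] ys) \<le> ?h x" if "l x = ys @ zs" for x ys zs
    proof -
      have *: "esize (g x y) \<le> poly q (1 + esize x + esize (l x))" if "y \<in> set (l x)" for y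
        using esize_mem[OF that] by (intro order.trans[OF q] poly_nat_mono) simp
      have "esize (concat (map (g x) ys)) \<le> 1 + length ys * poly q (1 + esize x + esize (l x))"
        if "set ys \<subseteq> set (l x)" for ys
        using that
      proof (induction ys)
        case (Cons y ys)
        then show ?case
          using *[of y] esize_append[of "g x y" "concat (map (g x) ys)"] by simp
      qed simp
      moreover have "length ys \<le> esize (l x)"
        using length_le_esize[of "l x"] that by simp
      ultimately have "esize (concat (map (g x) ys)) \<le> ?h x"
        using that by (force intro: order.trans mult_le_mono1)
      then show ?thesis
        using esize_rev[of "concat (map (g x) ys)"] unfolding eq by simp
    qed
    show "polytime (\<lambda>z. rev (g (fst z) (snd (snd z))) @ fst (snd z))"
      by (intro polytime_intros polytime_comp2[OF g])
  qed (intro polytime_intros l)+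
  then show ?thesis by (simp add: eq)
qed

lemma polytime_map [polytime_intros]:
  assumes "polytime l" "polytime (\<lambda>z. g (fst z) (snd z))"
  shows "polytime (\<lambda>x. map (g x) (l x))"
proof -
  have "polytime (\<lambda>x. concat (map (\<lambda>y. [g x y]) (l x)))"
    by (intro polytime_intros assms)
  then show ?thesis by (simp add: concat_map_singleton)
qed

lemma polytime_filter [polytime_intros]:
  assumes "polytime l" "polytime (\<lambda>z. P (fst z) (snd z))"
  shows "polytime (\<lambda>x. filter (P x) (l x))"
proof -
  have *: "concat (map (\<lambda>y. if P x y then [y] else []) ys) = filter (P x) ys" for x ys
    by (induction ys) auto
  have "polytime (\<lambda>x. concat (map (\<lambda>y. if P x y then [y] else []) (l x)))"
    by (intro polytime_intros assms)
  then show ?thesis by (simp add: *)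
qed

lemma polytime_Ball [polytime_intros]:
  assumes "polytime l" "polytime (\<lambda>z. P (fst z) (snd z))"
  shows "polytime (\<lambda>x. \<forall>y \<in> set (l x). P x y)"
proof -
  have "polytime (\<lambda>x. filter (\<lambda>y. \<not> P x y) (l x) = [])"
    by (intro polytime_intros assms)
  then show ?thesis by (simp add: filter_empty_conv)
qed

lemma polytime_Bex [polytime_intros]:
  assumes "polytime l" "polytime (\<lambda>z. P (fst z) (snd z))"
  shows "polytime (\<lambda>x. \<exists>y \<in> set (l x). P x y)"
proof -
  have "polytime (\<lambda>x. \<not> (\<forall>y \<in> set (l x). \<not> P x y))"
    by (intro polytime_intros assms)
  then show ?thesis by simp
qed

lemma polytime_mem [polytime_intros]:
  assumes "polytime f" "polytime l"
  shows "polytime (\<lambda>x. f x \<in> set (l x))"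
proof (rule polytime_comp2[OF _ assms])
  have "polytime (\<lambda>z. \<exists>y \<in> set (snd z). fst z = y)"
    by (intro polytime_intros)
  then show "polytime (\<lambda>z. fst z \<in> set (snd z))" by simp
qed

lemma polytime_suffixes [polytime_intros]:
  fixes l :: "'a::encodable \<Rightarrow> 'b::encodable list"
  assumes l: "polytime l"
  shows "polytime (\<lambda>x. suffixes (l x))"
proof -
  \<comment> \<open>The head of the accumulator is the longest suffix found so far. The start value
    \<open>[[]]\<close> keeps it nonempty, so the value at \<open>[]\<close> is a mere
    default.\<close>
  let ?g = "\<lambda>acc y. case acc of [] \<Rightarrow> [] | ys # _ \<Rightarrow> (y # ys) # acc"
  have eq: "foldl ?g [[]] ys = rev (suffixes (rev ys))" for ys :: "'b list"
  proof (induction ys rule: rev_induct)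
    case (snoc y ys)
    obtain zss where "rev (suffixes (rev ys)) = rev ys # zss"
      by (cases "rev ys") auto
    with snoc show ?case by simp
  qed simp
  have "polytime (\<lambda>x. rev (foldl ?g [[]] (rev (l x))))"
  proof (rule polytime_rev, rule polytime_foldl)
    let ?h = "\<lambda>x. Suc (Suc (esize (l x)) * Suc (esize (l x)))"
    show "poly_bounded ?h"
      by (intro poly_bounded_intros polytime_esize[OF l])
    show "esize (foldl ?g [[]] ys) \<le> ?h x" if "rev (l x) = ys @ zs" for x ys zs
    proof -
      have lx: "l x = rev zs @ rev ys" using that by (metis rev_append rev_rev_ident)
      have *: "esize y \<le> esize (l x)" if y: "y \<in> set (rev (suffixes (rev ys)))" for y
      proof -
        obtain us where "rev ys = us @ y" using y by (auto simp: suffix_def)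
        then obtain zs' where "l x = zs' @ y" using lx by (metis append.assoc)
        then show ?thesis using esize_append[of zs' y] dsize_pos[of "enc zs'"] by simp
      qed
      have len: "length (rev (suffixes (rev ys))) \<le> Suc (esize (l x))"
        using length_le_esize[of "l x"] lx by simp
      from * have "esize (rev (suffixes (rev ys)))
          \<le> Suc (length (rev (suffixes (rev ys))) * Suc (esize (l x)))"
        by (rule esize_list_le)
      also have "\<dots> \<le> ?h x"
        using mult_le_mono1[OF len] by (simp only: Suc_le_mono)
      finally show ?thesis unfolding eq .
    qed
  qed (intro polytime_intros l)+
  then show ?thesis by (simp add: eq)
qed

section \<open>Derivations\<close>

abbreviation lift :: "fm list sequent \<Rightarrow> fm set sequent" where
  "lift \<equiv> map_sequent set"

lemma lk_mono: "lk X S \<Longrightarrow> X \<subseteq> Y \<Longrightarrow> lk Y S"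
  by (induction rule: lk.induct) (blast intro: lk.intros)+

lemma mlk_mono: "mlk single X S \<Longrightarrow> X \<subseteq> Y \<Longrightarrow> mlk single Y S"
  by (induction rule: mlk.induct) (blast intro: mlk.intros lk_mono)+

text \<open>Here \<open>X\<close> holds the sequents already available, so blocks of the derivation
  can be checked separately and then concatenated. The argument \<open>True\<close> of
  \<open>mlk\<close> restricts \<open>M_left\<close> to its sound instances.\<close>

primrec derives :: "fm set sequent set \<Rightarrow> fm list sequent list \<Rightarrow> bool" where
  "derives X [] \<longleftrightarrow> True"
| "derives X (S # d) \<longleftrightarrow> mlk True X (lift S) \<and> derives (insert (lift S) X) d"

lemma derives_append: "derives X (d @ d') \<longleftrightarrow> derives X d \<and> derives (X \<union> lift ` set d) d'"
  by (induction d arbitrary: X) auto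

lemma derives_mono: "derives X d \<Longrightarrow> X \<subseteq> Y \<Longrightarrow> derives Y d"
proof (induction d arbitrary: X Y)
  case (Cons S d)
  then show ?case using mlk_mono Cons.IH[of "insert (lift S) X" "insert (lift S) Y"] by auto
qed simp

lemma derives_concat_map: "(\<And>x. x \<in> set l \<Longrightarrow> derives X (f x)) \<Longrightarrow> derives X (concat (map f l))"
proof (induction l)
  case (Cons x l)
  then show ?case by (auto simp: derives_append intro: derives_mono)
qed simp

lemma derives_map: "(\<And>x. x \<in> set l \<Longrightarrow> mlk True X (lift (f x))) \<Longrightarrow> derives X (map f l)"
  using derives_concat_map[of l X "\<lambda>x. [f x]"] by (simp add: concat_map_singleton)

lemma mlk_derivation_if_derives:
  assumes "derives {} d"
  shows "mlk_derivation True d"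
  unfolding mlk_derivation_def
proof (intro allI impI)
  fix i assume i: "i < length d"
  then have "d = take i d @ d ! i # drop (Suc i) d" by (rule id_take_nth_drop)
  with assms have "derives {} (take i d @ d ! i # drop (Suc i) d)" by simp
  then show "mlk True (lift ` set (take i d)) (lift (d ! i))"
    by (simp add: derives_append)
qed

section \<open>Classical sequents as lists of signed formulas\<close>

fun opp :: "signed \<Rightarrow> signed" where
  "opp (T A) = F A"
| "opp (F A) = T A"

text \<open>Refuting the labels \<open>S\<close> of a branch amounts to deriving \<open>set_seq S\<close>.\<close>

definition set_seq :: "signed set \<Rightarrow> fm set sequent" where
  "set_seq S = ({A. T A \<in> S} \<turnstile> {A. F A \<in> S})"

text \<open>The signs are tested by equations, in place of pattern matching, so that the closure
  properties of polynomial time apply.\<close>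

definition seq :: "signed list \<Rightarrow> fm list sequent" where
  "seq ss = (map form (filter (\<lambda>s. s = T (form s)) ss) \<turnstile> map form (filter (\<lambda>s. s = F (form s)) ss))"

lemma lift_seq [simp]: "lift (seq ss) = set_seq (set ss)"
proof -
  have "form ` {s \<in> S. s = T (form s)} = {A. T A \<in> S}" for S
    by (auto simp: image_iff) force
  moreover have "form ` {s \<in> S. s = F (form s)} = {A. F A \<in> S}" for S
    by (auto simp: image_iff) force
  ultimately show ?thesis by (simp add: seq_def set_seq_def)
qed

lemma set_seq_insert:
  "set_seq (insert (T A) S) = (insert A {A. T A \<in> S} \<turnstile> {A. F A \<in> S})"
  "set_seq (insert (F A) S) = ({A. T A \<in> S} \<turnstile> insert A {A. F A \<in> S})"
  by (auto simp: set_seq_def)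

lemma mlk_weaken: "set_seq S \<in> X \<Longrightarrow> mlk True X (set_seq (insert s S))"
  by (cases s) (auto simp: set_seq_insert set_seq_def[of S] intro!: mlk.lk weakL weakR)

lemma mlk_cut:
  "set_seq (insert s S) \<in> X \<Longrightarrow> set_seq (insert (opp s) S) \<in> X \<Longrightarrow> mlk True X (set_seq S)"
  by (cases s) (auto simp: set_seq_insert set_seq_def[of S] intro: mlk.lk cut)

lemma mlk_ax: "mlk True X (set_seq {T A, F A})"
  using mlk.lk[OF lk.ax[of X A]] by (simp add: set_seq_def)

text \<open>\<open>suffixes\<close> lists shorter suffixes before longer ones, so each sequent adds
  one formula to its predecessor. The empty suffix, removed by \<open>tl\<close>, stands for the
  base itself.\<close>

definition weakenings :: "signed list list \<Rightarrow> signed list \<Rightarrow> fm list sequent list" where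
  "weakenings bs S = concat (map (\<lambda>b. map (\<lambda>s. seq (s @ b)) (tl (suffixes S))) bs)"

lemma derives_weakenings:
  assumes "\<And>b. b \<in> set bs \<Longrightarrow> set_seq (set b) \<in> X"
  shows "derives X (weakenings bs S)"
  unfolding weakenings_def
proof (rule derives_concat_map)
  fix b assume "b \<in> set bs"
  then have b: "set_seq (set b) \<in> X" by (rule assms)
  have "derives X (map (\<lambda>s. seq (s @ b)) (tl (suffixes S))) \<and>
      set_seq (set (S @ b)) \<in> X \<union> lift ` set (map (\<lambda>s. seq (s @ b)) (tl (suffixes S)))"
    by (induction S) (auto simp: b derives_append intro!: mlk_weaken)
  then show "derives X (map (\<lambda>s. seq (s @ b)) (tl (suffixes S)))" by blast
qed

text \<open>Sequents are compared as sets, so weakening a base by all of \<open>S\<close> ends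
  exactly at \<open>S'\<close>, also when \<open>S\<close> repeats formulas of the base. For empty
  \<open>S\<close> the base itself is the result.\<close>

lemma weakenings_result:
  assumes "b \<in> set bs" "set_seq (set b) \<in> X" "set b \<subseteq> S'" "set S \<union> set b = S'"
  shows "set_seq S' \<in> X \<union> lift ` set (weakenings bs S)"
proof (cases S)
  case Nil
  with assms show ?thesis by simp
next
  case (Cons s S1)
  then have "seq (S @ b) \<in> set (weakenings bs S)"
    using assms(1) by (auto simp: weakenings_def)
  then have "lift (seq (S @ b)) \<in> lift ` set (weakenings bs S)" by (rule imageI)
  then show ?thesis using assms(4) by simp
qed

section \<open>The sequents of the tableau rules\<close>


lemma mlk_negL: "set_seq (insert (F A) S) \<in> X \<Longrightarrow> mlk True X (set_seq (insert (T (Neg A)) S))"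
  by (auto simp: set_seq_insert intro: mlk.lk negL)

lemma mlk_negR: "set_seq (insert (T A) S) \<in> X \<Longrightarrow> mlk True X (set_seq (insert (F (Neg A)) S))"
  by (auto simp: set_seq_insert intro: mlk.lk negR)

lemma mlk_conL1: "set_seq (insert (T A) S) \<in> X \<Longrightarrow> mlk True X (set_seq (insert (T (Con A B)) S))"
  by (auto simp: set_seq_insert intro: mlk.lk conL1)

lemma mlk_conL2: "set_seq (insert (T B) S) \<in> X \<Longrightarrow> mlk True X (set_seq (insert (T (Con A B)) S))"
  by (auto simp: set_seq_insert intro: mlk.lk conL2)

lemma mlk_conR:
  "set_seq (insert (F A) S) \<in> X \<Longrightarrow> set_seq (insert (F B) S) \<in> X
    \<Longrightarrow> mlk True X (set_seq (insert (F (Con A B)) S))"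
  by (auto simp: set_seq_insert intro: mlk.lk conR)

lemma mlk_disL:
  "set_seq (insert (T A) S) \<in> X \<Longrightarrow> set_seq (insert (T B) S) \<in> X
    \<Longrightarrow> mlk True X (set_seq (insert (T (Dis A B)) S))"
  by (auto simp: set_seq_insert intro: mlk.lk disL)

lemma mlk_disR1: "set_seq (insert (F A) S) \<in> X \<Longrightarrow> mlk True X (set_seq (insert (F (Dis A B)) S))"
  by (auto simp: set_seq_insert intro: mlk.lk disR1)

lemma mlk_disR2: "set_seq (insert (F B) S) \<in> X \<Longrightarrow> mlk True X (set_seq (insert (F (Dis A B)) S))"
  by (auto simp: set_seq_insert intro: mlk.lk disR2)

lemma mlk_impL:
  "set_seq (insert (F A) S) \<in> X \<Longrightarrow> set_seq (insert (T B) S) \<in> X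
    \<Longrightarrow> mlk True X (set_seq (insert (T (Imp A B)) S))"
  by (auto simp: set_seq_insert intro: mlk.lk impL)

lemma mlk_impR:
  assumes "set_seq (insert (T A) (insert (F B) S)) \<in> X"
  shows "mlk True X (set_seq (insert (F (Imp A B)) S))"
proof -
  have "set_seq (insert (T A) (insert (F B) S)) = (insert A {A. T A \<in> S} \<turnstile> insert B {A. F A \<in> S})"
    by (auto simp: set_seq_def)
  then show ?thesis using assms by (auto simp: set_seq_insert intro: mlk.lk impR)
qed

text \<open>
  Every sequent follows from earlier ones by one rule, which introduces its first formula.
\<close>

definition templates :: "fm \<Rightarrow> fm \<Rightarrow> signed list list" where
  "templates A B =
    [[T A, F A], [T B, F B],
     [T (Neg A), T A], [F (Neg A), F A], [T (Neg B), T B], [F (Neg B), F B],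
     [F (Neg A), T (Neg A)],
     [T B, T A, F A], [T A, T B, F B], [F B, T A, F A], [F A, T B, F B],
     [T (Neg (Neg A)), F A], [F (Neg (Neg A)), T A],
     [T (Con A B), F A], [T (Con A B), F B], [F (Con A B), T A, T B],
     [T (Neg A), T (Con A B)], [F (Neg (Con A B)), T (Neg A)],
     [T (Neg B), T (Con A B)], [F (Neg (Con A B)), T (Neg B)],
     [F (Neg B), F (Con A B), T A], [F (Neg A), F (Con A B), F (Neg B)],
     [T (Neg (Con A B)), F (Neg A), F (Neg B)],
     [F (Dis A B), T A], [F (Dis A B), T B], [T (Dis A B), F A, F B],
     [T (Neg (Dis A B)), T A], [F (Neg A), T (Neg (Dis A B))],
     [T (Neg (Dis A B)), T B], [F (Neg B), T (Neg (Dis A B))],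
     [T (Neg A), T (Dis A B), F B], [T (Neg B), T (Neg A), T (Dis A B)],
     [F (Neg (Dis A B)), T (Neg A), T (Neg B)],
     [F B, F (Neg A), F A], [F (Neg A), T B, F B], [T (Imp A B), F (Neg A), F B],
     [F B, T (Neg A), T A], [F (Imp A B), T (Neg A)], [F (Imp A B), T B],
     [T (Imp A B), T A, F B], [T (Neg B), T (Imp A B), T A],
     [F (Neg (Imp A B)), T A, T (Neg B)],
     [F (Imp A B), F A], [T (Neg (Imp A B)), F A],
     [T (Neg (Imp A B)), T B], [F (Neg B), T (Neg (Imp A B))]]"

lemma derives_templates: "derives X (map seq (templates A B))"
  unfolding templates_def list.map derives.simps lift_seq list.set
  by (intro conjI TrueI;
      (rule mlk_ax | (rule mlk_negL; simp add: insert_commute; fail)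
       | (rule mlk_negR; simp add: insert_commute; fail)
       | (rule mlk_weaken; simp add: insert_commute; fail)
       | (rule mlk_conL1; simp add: insert_commute; fail)
       | (rule mlk_conL2; simp add: insert_commute; fail)
       | (rule mlk_conR; simp add: insert_commute; fail)
       | (rule mlk_disL; simp add: insert_commute; fail)
       | (rule mlk_disR1; simp add: insert_commute; fail)
       | (rule mlk_disR2; simp add: insert_commute; fail)
       | (rule mlk_impL; simp add: insert_commute; fail)
       | (rule mlk_impR; simp add: insert_commute; fail)))

section \<open>Covering the tableau rules by templates\<close>

definition covered :: "signed list list \<Rightarrow> signed set \<Rightarrow> bool" where
  "covered bs S \<longleftrightarrow> (\<exists>b \<in> set bs. set b = S)"

text \<open>The components of a tableau rule are the subformulas \<open>A\<close>, \<open>B\<close>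
  of the decomposed connective or their negations. Hence the parameters of the template are
  recovered from the components by removing at most one negation.\<close>

primrec strip :: "fm \<Rightarrow> fm" where
  "strip (Neg A) = A"
| "strip (Atom p) = Atom p"
| "strip Bot = Bot"
| "strip Top = Top"
| "strip (Con A B) = Con A B"
| "strip (Dis A B) = Dis A B"
| "strip (Imp A B) = Imp A B"

definition all_templates :: "fm list \<Rightarrow> signed list list" where
  "all_templates U = concat (map (\<lambda>A. concat (map (templates A) U)) U)"

lemma derives_all_templates: "derives X (map seq (all_templates U))"
  unfolding all_templates_def map_concat map_map comp_def
  by (intro derives_concat_map derives_templates)

lemma all_templatesI: "A \<in> set U \<Longrightarrow> B \<in> set U \<Longrightarrow> b \<in> set (templates A B) \<Longrightarrow> b \<in> set (all_templates U)"
  unfolding all_templates_def by auto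

lemma covered_if_template:
  "A \<in> set U \<Longrightarrow> B \<in> set U \<Longrightarrow> \<exists>b \<in> set (templates A B). set b = S
    \<Longrightarrow> covered (all_templates U) S"
  unfolding covered_def by (meson all_templatesI)

text \<open>A set of signed formulas stands for its refutation. The first two sets say that
  \<open>s\<close> implies each component and are used to close the tableau; the third says that the
  components together imply \<open>s\<close> and is used to climb from the leaf of a model back to
  \<Gamma>.\<close>

lemma covered_alpha:
  assumes "alpha s s1 s2"
    and "{form s1, strip (form s1), form s2, strip (form s2)} \<subseteq> set U"
  shows "covered (all_templates U) {s, opp s1}" "covered (all_templates U) {s, opp s2}"
    "covered (all_templates U) {opp s, s1, s2}"
proof -
  obtain A B where "A \<in> set U" "B \<in> set U" "\<exists>b \<in> set (templates A B). set b = {s, opp s1}"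
      "\<exists>b \<in> set (templates A B). set b = {s, opp s2}"
      "\<exists>b \<in> set (templates A B). set b = {opp s, s1, s2}"
    using assms
  proof cases
    case (1 A B)
    show ?thesis by (rule that[of A B]) (use 1 assms in \<open>auto simp: templates_def insert_commute\<close>)
  next
    case (2 A B)
    show ?thesis by (rule that[of A B]) (use 2 assms in \<open>auto simp: templates_def insert_commute\<close>)
  next
    case (3 A B)
    show ?thesis by (rule that[of A B]) (use 3 assms in \<open>auto simp: templates_def insert_commute\<close>)
  next
    case (4 A B)
    show ?thesis by (rule that[of A B]) (use 4 assms in \<open>auto simp: templates_def insert_commute\<close>)
  next
    case (5 A B)
    show ?thesis by (rule that[of A B]) (use 5 assms in \<open>auto simp: templates_def insert_commute\<close>)
  next
    case (6 A B)
    show ?thesis by (rule that[of A B]) (use 6 assms in \<open>auto simp: templates_def insert_commute\<close>)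
  next
    case (7 A)
    show ?thesis by (rule that[of A A]) (use 7 assms in \<open>auto simp: templates_def insert_commute\<close>)
  next
    case (8 A)
    show ?thesis by (rule that[of A A]) (use 8 assms in \<open>auto simp: templates_def insert_commute\<close>)
  qed
  then show "covered (all_templates U) {s, opp s1}" "covered (all_templates U) {s, opp s2}"
    "covered (all_templates U) {opp s, s1, s2}"
    by (blast intro: covered_if_template)+
qed

text \<open>Dually, \<open>s\<close> implies one of its components, and either component alone
  implies \<open>s\<close>.\<close>

lemma covered_beta:
  assumes "beta s s1 s2"
    and "{form s1, strip (form s1), form s2, strip (form s2)} \<subseteq> set U"
  shows "covered (all_templates U) {s, opp s1, opp s2}"
    "covered (all_templates U) {opp s, s1}" "covered (all_templates U) {opp s, s2}"
proof -
  obtain A B where "A \<in> set U" "B \<in> set U" "\<exists>b \<in> set (templates A B). set b = {s, opp s1, opp s2}"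
      "\<exists>b \<in> set (templates A B). set b = {opp s, s1}"
      "\<exists>b \<in> set (templates A B). set b = {opp s, s2}"
    using assms
  proof cases
    case (1 A B)
    show ?thesis by (rule that[of A B]) (use 1 assms in \<open>auto simp: templates_def insert_commute\<close>)
  next
    case (2 A B)
    show ?thesis by (rule that[of A B]) (use 2 assms in \<open>auto simp: templates_def insert_commute\<close>)
  next
    case (3 A B)
    show ?thesis by (rule that[of A B]) (use 3 assms in \<open>auto simp: templates_def insert_commute\<close>)
  next
    case (4 A B)
    show ?thesis by (rule that[of A B]) (use 4 assms in \<open>auto simp: templates_def insert_commute\<close>)
  next
    case (5 A B)
    show ?thesis by (rule that[of A B]) (use 5 assms in \<open>auto simp: templates_def insert_commute\<close>)
  next
    case (6 A B)
    show ?thesis by (rule that[of A B]) (use 6 assms in \<open>auto simp: templates_def insert_commute\<close>)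
  qed
  then show "covered (all_templates U) {s, opp s1, opp s2}"
    "covered (all_templates U) {opp s, s1}" "covered (all_templates U) {opp s, s2}"
    by (blast intro: covered_if_template)+
qed

abbreviation after :: "fm set sequent set \<Rightarrow> fm list sequent list \<Rightarrow> fm set sequent set" where
  "after X d \<equiv> X \<union> lift ` set d"

section \<open>Minimal entailment\<close>

definition grid :: "fm list \<Rightarrow> fm list \<Rightarrow> fm list \<Rightarrow> fm list sequent list" where
  "grid X Y Z = concat (map (\<lambda>s. map (\<lambda>A. X @ s \<turnstile>\<^sub>M [A]) Z) (tl (suffixes Y)))"

text \<open>\<open>M_left\<close> needs both the new formula and the conclusion over the same
  context. So each time one formula of \<open>Y\<close> joins the context, all of \<open>Z\<close>,
  which includes the formulas of \<open>Y\<close> still to come, is derived anew: a two-dimensional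
  array of sequents.\<close>

lemma derives_grid:
  assumes "\<And>A. A \<in> set Z \<Longrightarrow> (set X \<turnstile>\<^sub>M {A}) \<in> S" "set Y \<subseteq> set Z"
  shows "derives S (grid X Y Z) \<and>
    (\<forall>s A. suffix s Y \<longrightarrow> A \<in> set Z \<longrightarrow> (set (X @ s) \<turnstile>\<^sub>M {A}) \<in> after S (grid X Y Z))"
  using assms(2)
proof (induction Y)
  case Nil
  then show ?case using assms(1) by (simp add: grid_def)
next
  case (Cons B Y)
  let ?d = "map (\<lambda>A. X @ B # Y \<turnstile>\<^sub>M [A]) Z"
  have d: "grid X (B # Y) Z = grid X Y Z @ ?d" by (simp add: grid_def)
  have IH: "derives S (grid X Y Z)"
    "\<And>s A. suffix s Y \<Longrightarrow> A \<in> set Z \<Longrightarrow> (set (X @ s) \<turnstile>\<^sub>M {A}) \<in> after S (grid X Y Z)"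
    using Cons by auto
  have "derives (after S (grid X Y Z)) ?d"
  proof (rule derives_map)
    fix A assume "A \<in> set Z"
    then have "mlk True (after S (grid X Y Z)) (set (X @ Y) \<union> {B} \<turnstile>\<^sub>M {A})"
      using Cons.prems by (intro M_left IH(2)) auto
    then show "mlk True (after S (grid X Y Z)) (lift (X @ B # Y \<turnstile>\<^sub>M [A]))" by simp
  qed
  moreover have "(set (X @ s) \<turnstile>\<^sub>M {A}) \<in> after S (grid X (B # Y) Z)"
    if "suffix s (B # Y)" "A \<in> set Z" for s A
  proof (cases "s = B # Y")
    case True
    have "lift (X @ B # Y \<turnstile>\<^sub>M [A]) \<in> lift ` set ?d"
      using that(2) by (intro imageI) simp
    with True show ?thesis unfolding d by (simp add: image_Un)
  next
    case False
    with that IH(2)[of s A] show ?thesis unfolding d by (auto simp: suffix_Cons)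
  qed
  ultimately show ?case using IH(1) unfolding d by (simp add: derives_append)
qed

definition cuts :: "fm list \<Rightarrow> fm list \<Rightarrow> fm list \<Rightarrow> fm list sequent list" where
  "cuts X Y R = map (\<lambda>s. X @ s \<turnstile>\<^sub>M R) (rev (suffixes Y))"

text \<open>The premises of \<open>M_cut\<close> share their context, so a formula is cut by means
  of its derivation from exactly those formulas that remain. Cutting goes from the head of
  \<open>Y\<close> to its end.\<close>

lemma derives_cuts:
  assumes "\<And>A s. suffix (A # s) Y \<Longrightarrow> (set (X @ s) \<turnstile>\<^sub>M {A}) \<in> S" "mlk True S (set (X @ Y) \<turnstile>\<^sub>M set R)"
  shows "derives S (cuts X Y R) \<and> (\<forall>s. suffix s Y \<longrightarrow> (set (X @ s) \<turnstile>\<^sub>M set R) \<in> after S (cuts X Y R))"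
  using assms
proof (induction Y arbitrary: S)
  case Nil
  then show ?case by (simp add: cuts_def)
next
  case (Cons A Y)
  let ?S = "insert (set (X @ A # Y) \<turnstile>\<^sub>M set R) S"
  have d: "cuts X (A # Y) R = (X @ A # Y \<turnstile>\<^sub>M R) # cuts X Y R" by (simp add: cuts_def)
  have "mlk True ?S (set (X @ Y) \<turnstile>\<^sub>M {} \<union> set R)"
    by (rule M_cut[where A = A]) (use Cons.prems(1)[of A Y] in auto)
  then have "mlk True ?S (set (X @ Y) \<turnstile>\<^sub>M set R)" by simp
  then have "derives ?S (cuts X Y R) \<and>
      (\<forall>s. suffix s Y \<longrightarrow> (set (X @ s) \<turnstile>\<^sub>M set R) \<in> after ?S (cuts X Y R))"
    using Cons.prems(1) by (intro Cons.IH) (blast intro: suffix_ConsI)+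
  with Cons.prems(2) show ?case unfolding d by (auto simp: suffix_Cons)
qed

definition all_cuts :: "fm list \<Rightarrow> fm list \<Rightarrow> fm list sequent list" where
  "all_cuts X Y = concat (map (\<lambda>u. case u of [] \<Rightarrow> [] | A # s \<Rightarrow> cuts X s [A]) (suffixes Y))"

text \<open>Each formula of \<open>Y\<close> is given over the formulas behind it. Shorter suffixes
  are treated first, so when the tail of \<open>A\<close> is to be cut, every formula in it is
  available over each of the smaller contexts that occur.\<close>

lemma derives_all_cuts:
  assumes "\<And>A s. suffix (A # s) Y \<Longrightarrow> mlk True S (set (X @ s) \<turnstile>\<^sub>M {A})"
  shows "derives S (all_cuts X Y) \<and>
    (\<forall>A s s'. suffix (A # s) Y \<longrightarrow> suffix s' s \<longrightarrow> (set (X @ s') \<turnstile>\<^sub>M {A}) \<in> after S (all_cuts X Y))"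
  using assms
proof (induction Y)
  case Nil
  then show ?case by (simp add: all_cuts_def)
next
  case (Cons A Y)
  let ?S = "after S (all_cuts X Y)"
  have d: "all_cuts X (A # Y) = all_cuts X Y @ cuts X Y [A]" by (simp add: all_cuts_def)
  have IH: "derives S (all_cuts X Y)"
    "\<And>B s s'. suffix (B # s) Y \<Longrightarrow> suffix s' s \<Longrightarrow> (set (X @ s') \<turnstile>\<^sub>M {B}) \<in> ?S"
    using Cons by (auto simp: suffix_Cons)
  have "mlk True ?S (set (X @ Y) \<turnstile>\<^sub>M {A})"
    using Cons.prems[of A Y] by (auto intro: mlk_mono)
  then have "derives ?S (cuts X Y [A]) \<and>
      (\<forall>s. suffix s Y \<longrightarrow> (set (X @ s) \<turnstile>\<^sub>M set [A]) \<in> after ?S (cuts X Y [A]))"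
  proof (intro derives_cuts)
    show "(set (X @ s) \<turnstile>\<^sub>M {B}) \<in> ?S" if "suffix (B # s) Y" for B s
      by (rule IH(2)[OF that]) simp
  qed simp
  with IH show ?case unfolding d by (auto simp: derives_append suffix_Cons image_Un)
qed

text \<open>The curried form is reached by \<open>M_impR\<close> alone. A conjunction as premise
  would have to be assembled on the left of \<open>\<turnstile>\<^sub>M\<close>, where no
  conjunction rule exists.\<close>

definition imp_chain :: "fm list \<Rightarrow> fm \<Rightarrow> fm" where
  "imp_chain bs a = foldr Imp bs (Neg a)"

text \<open>At most one \<open>p\<close> passes the test; it consists of the formulas not yet discharged.\<close>

definition discharge :: "fm list \<Rightarrow> fm list \<Rightarrow> fm \<Rightarrow> fm list \<Rightarrow> fm list sequent list" where
  "discharge X bs a q =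
    concat (map (\<lambda>p. if p @ q = bs then [X @ p \<turnstile>\<^sub>M [imp_chain q a]] else []) (prefixes bs))"

definition discharges :: "fm list \<Rightarrow> fm list \<Rightarrow> fm \<Rightarrow> fm list sequent list" where
  "discharges X bs a = concat (map (discharge X bs a) (tl (suffixes bs)))"

text \<open>Formulas leave the context from the end of \<open>bs\<close>. The induction is on the
  discharged part \<open>q\<close>, and moving one more formula to it is one application of
  \<open>M_impR\<close>.\<close>

lemma derives_discharges:
  assumes "(set (X @ bs) \<turnstile>\<^sub>M {Neg a}) \<in> S"
  shows "derives S (discharges X bs a)" "(set X \<turnstile>\<^sub>M {imp_chain bs a}) \<in> after S (discharges X bs a)"
proof -
  have "derives S (concat (map (discharge X bs a) (tl (suffixes q)))) \<and>
      (set (X @ p) \<turnstile>\<^sub>M {imp_chain q a}) \<in> after S (concat (map (discharge X bs a) (tl (suffixes q))))"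
    if "p @ q = bs" for p q
    using that
  proof (induction q arbitrary: p)
    case Nil
    then show ?case using assms by (simp add: imp_chain_def)
  next
    case (Cons b q)
    let ?d = "concat (map (discharge X bs a) (tl (suffixes q)))"
    have d: "concat (map (discharge X bs a) (tl (suffixes (b # q)))) = ?d @ discharge X bs a (b # q)"
      by simp
    have IH: "derives S ?d" "(set (X @ p @ [b]) \<turnstile>\<^sub>M {imp_chain q a}) \<in> after S ?d"
      using Cons.IH[of "p @ [b]"] Cons.prems by simp_all
    have "mlk True (after S ?d) (set (X @ p) \<turnstile>\<^sub>M insert (Imp b (imp_chain q a)) {})"
      using IH(2) by (intro M_impR) simp
    then have *: "mlk True (after S ?d) (lift (X @ p \<turnstile>\<^sub>M [imp_chain (b # q) a]))"
      by (simp add: imp_chain_def)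
    have "derives Y (discharge X bs a (b # q))" if "mlk True Y (lift (X @ p \<turnstile>\<^sub>M [imp_chain (b # q) a]))" for Y
      unfolding discharge_def by (rule derives_concat_map) (use that Cons.prems in auto)
    from this[OF *] have "derives (after S ?d) (discharge X bs a (b # q))" .
    moreover have "(X @ p \<turnstile>\<^sub>M [imp_chain (b # q) a]) \<in> set (discharge X bs a (b # q))"
      using Cons.prems unfolding discharge_def by (auto simp: prefix_def intro!: bexI[of _ p])
    then have "lift (X @ p \<turnstile>\<^sub>M [imp_chain (b # q) a]) \<in> lift ` set (discharge X bs a (b # q))"
      by (rule imageI)
    ultimately show ?case using IH(1) unfolding d by (simp add: derives_append image_Un)
  qed
  from this[of "[]" bs]
  show "derives S (discharges X bs a)" "(set X \<turnstile>\<^sub>M {imp_chain bs a}) \<in> after S (discharges X bs a)"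
    unfolding discharges_def by simp_all
qed

section \<open>Sequents from a completed branch\<close>

definition true_forms :: "signed list \<Rightarrow> fm list" where
  "true_forms L = map form (filter (\<lambda>s. s = T (form s)) L)"

lemma set_true_forms [simp]: "A \<in> set (true_forms L) \<longleftrightarrow> T A \<in> set L"
  by (auto simp: true_forms_def image_iff)

definition is_atom :: "fm \<Rightarrow> bool" where
  "is_atom A \<longleftrightarrow> (\<exists>p. A = Atom p)"

definition true_atoms :: "signed list \<Rightarrow> fm list" where
  "true_atoms L = filter is_atom (true_forms L)"

text \<open>The last condition makes \<open>M_ax\<close> applicable to every formula in this list,
  even if the labels contain an atom together with its negation.\<close>

definition false_atoms :: "signed list \<Rightarrow> fm list" where
  "false_atoms L =
    filter (\<lambda>A. A = Neg (strip A) \<and> is_atom (strip A) \<and> strip A \<notin> set (true_atoms L)) (true_forms L)"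

text \<open>
  Every true formula follows by a single template from later true formulas of the branch and
  its literals. This test replaces the one for completed branches that are not \<open>T\<close>-closed; it
  needs no marks and is exactly what the derivation of \<open>\<Gamma>\<close> from the literals uses.
\<close>

definition saturated :: "signed list list \<Rightarrow> signed list \<Rightarrow> bool" where
  "saturated bs L \<longleftrightarrow> (\<forall>u \<in> set (suffixes (true_forms L)). case u of [] \<Rightarrow> True | A # s \<Rightarrow>
     \<exists>b \<in> set bs. \<forall>x \<in> set b. x \<in> set (F A # map T (true_atoms L @ s @ false_atoms L)))"

lemma saturatedD:
  assumes "saturated bs L" "suffix (A # s) (true_forms L)"
  shows "\<exists>b \<in> set bs. set b \<subseteq> set (F A # map T (true_atoms L @ s @ false_atoms L))"
proof -
  have "A # s \<in> set (suffixes (true_forms L))" using assms(2) by simp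
  from bspec[OF assms(1)[unfolded saturated_def] this] show ?thesis
    unfolding list.case subset_eq .
qed

definition model_part :: "signed list list \<Rightarrow> fm list \<Rightarrow> fm list \<Rightarrow> signed list \<Rightarrow> fm list sequent list" where
  "model_part bs X as L =
     concat (map (\<lambda>u. case u of [] \<Rightarrow> [] | A # s \<Rightarrow>
       weakenings bs (F A # map T (true_atoms L @ s @ false_atoms L))) (suffixes (true_forms L))) @
     all_cuts (true_atoms L) (true_forms L @ false_atoms L) @
     map (\<lambda>a. true_atoms L \<turnstile>\<^sub>M [Neg a]) as @
     grid (true_atoms L) X (X @ map Neg as) @
     concat (map (discharges X (true_atoms L)) as)"

text \<open>Saturation gives each true formula classically from the atoms, the later true formulas
  and the negative literals. The literals are placed at the end, so that each of them is an axiom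
  over a context of literals only. Cutting everything but the atoms leaves \<Gamma> derived
  minimally from the atoms, which is what allows \<Gamma> to be added to them.\<close>

lemma derives_model_part:
  assumes bs: "\<And>b. b \<in> set bs \<Longrightarrow> set_seq (set b) \<in> S"
    and sat: "saturated bs L"
    and X: "set X \<subseteq> set (true_forms L)"
    and as: "\<And>a. a \<in> set as \<Longrightarrow> is_atom a \<and> a \<notin> set (true_atoms L)"
  shows "derives S (model_part bs X as L) \<and>
    (\<forall>a \<in> set as. (set X \<turnstile>\<^sub>M {imp_chain (true_atoms L) a}) \<in> after S (model_part bs X as L))"
proof -
  let ?P = "true_atoms L" and ?N = "false_atoms L"
  let ?f = "\<lambda>u. case u of [] \<Rightarrow> [] | A # s \<Rightarrow> weakenings bs (F A # map T (?P @ s @ ?N))"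
  define d1 where "d1 = concat (map ?f (suffixes (true_forms L)))"
  define d2 where "d2 = all_cuts ?P (true_forms L @ ?N)"
  define d3 where "d3 = map (\<lambda>a. ?P \<turnstile>\<^sub>M [Neg a]) as"
  define d4 where "d4 = grid ?P X (X @ map Neg as)"
  define d5 where "d5 = concat (map (discharges X ?P) as)"
  have d: "model_part bs X as L = d1 @ d2 @ d3 @ d4 @ d5"
    unfolding model_part_def d1_def d2_def d3_def d4_def d5_def ..
  \<comment> \<open>An atom occurs positively in no atom but itself and in no negated atom; this is
    the side condition of \<open>M_ax\<close>.\<close>
  have no_pos: "\<not> occurs True p A" if "Atom p \<notin> set ?P" "A \<in> set ?P \<union> set ?N" for p A
    using that by (auto simp: true_atoms_def false_atoms_def is_atom_def)
  have 1: "derives S d1" unfolding d1_def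
  proof (rule derives_concat_map)
    show "derives S (?f u)" for u
      using derives_weakenings[OF bs] by (cases u) auto
  qed
  have p1: "(set (?P @ s @ ?N) \<turnstile> {A}) \<in> after S d1" if "suffix (A # s) (true_forms L)" for A s
  proof -
    obtain b where b: "b \<in> set bs" "set b \<subseteq> set (F A # map T (?P @ s @ ?N))"
      using saturatedD[OF sat \<open>suffix (A # s) (true_forms L)\<close>] by blast
    have "set_seq (set (F A # map T (?P @ s @ ?N)))
        \<in> after S (weakenings bs (F A # map T (?P @ s @ ?N)))"
      by (rule weakenings_result[OF b(1)]) (use b bs in auto)
    moreover have "set (weakenings bs (F A # map T (?P @ s @ ?N))) \<subseteq> set d1"
      using that unfolding d1_def by (auto intro!: bexI[of _ "A # s"])
    moreover have "set_seq (set (F A # map T (?P @ s @ ?N))) = (set (?P @ s @ ?N) \<turnstile> {A})"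
      by (auto simp: set_seq_def)
    ultimately show ?thesis by auto
  qed
  have 2: "derives (after S d1) d2 \<and> (\<forall>A s s'. suffix (A # s) (true_forms L @ ?N) \<longrightarrow> suffix s' s
      \<longrightarrow> (set (?P @ s') \<turnstile>\<^sub>M {A}) \<in> after (after S d1) d2)"
    unfolding d2_def
  proof (rule derives_all_cuts)
    fix A u assume "suffix (A # u) (true_forms L @ ?N)"
    then consider "suffix (A # u) ?N" | s where "u = s @ ?N" "suffix (A # s) (true_forms L)"
      by (auto simp: suffix_append Cons_eq_append_conv)
    then show "mlk True (after S d1) (set (?P @ u) \<turnstile>\<^sub>M {A})"
    proof cases
      case 1
      then have u: "A \<in> set ?N" "set u \<subseteq> set ?N"
        using set_mono_suffix[OF 1] by auto
      then obtain p where "A = Neg (Atom p)" "Atom p \<notin> set ?P"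
        by (auto simp: false_atoms_def is_atom_def)
      then show ?thesis using no_pos u(2) by (auto intro!: M_ax)
    next
      case 2
      then show ?thesis using p1 by (auto intro!: M_lk)
    qed
  qed
  have p2: "(set ?P \<turnstile>\<^sub>M {A}) \<in> after (after S d1) d2" if "A \<in> set (true_forms L)" for A
  proof -
    from split_list[OF that] obtain us s where "true_forms L = us @ A # s" by blast
    then have "suffix (A # s @ ?N) (true_forms L @ ?N)" by (auto simp: suffix_def)
    then show ?thesis using 2[THEN conjunct2, rule_format, of A "s @ ?N" "[]"] by simp
  qed
  have 3: "derives (after (after S d1) d2) d3" unfolding d3_def
  proof (rule derives_map)
    fix a assume "a \<in> set as"
    then obtain p where "a = Atom p" "Atom p \<notin> set ?P" using as by (auto simp: is_atom_def)
    then show "mlk True (after (after S d1) d2) (lift (?P \<turnstile>\<^sub>M [Neg a]))"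
      using no_pos by (auto intro!: M_ax)
  qed
  have p3: "(set ?P \<turnstile>\<^sub>M {Neg a}) \<in> after (after (after S d1) d2) d3" if "a \<in> set as" for a
  proof -
    have "lift (?P \<turnstile>\<^sub>M [Neg a]) \<in> lift ` set d3"
      using that unfolding d3_def by (intro imageI) simp
    then show ?thesis by simp
  qed
  let ?S = "after (after (after S d1) d2) d3"
  have 4: "derives ?S d4 \<and> (\<forall>s A. suffix s X \<longrightarrow> A \<in> set (X @ map Neg as)
      \<longrightarrow> (set (?P @ s) \<turnstile>\<^sub>M {A}) \<in> after ?S d4)"
    unfolding d4_def
  proof (rule derives_grid)
    show "(set ?P \<turnstile>\<^sub>M {A}) \<in> ?S" if "A \<in> set (X @ map Neg as)" for A
    proof -
      consider "A \<in> set X" | a where "A = Neg a" "a \<in> set as" using \<open>A \<in> set (X @ map Neg as)\<close> by auto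
      then show ?thesis
        by cases (use X p2[of A] p3 in auto)
    qed
  qed simp
  \<comment> \<open>All of \<open>X\<close> now stands beside the atoms. As sets the two lists may
    be exchanged, which puts the atoms last, ready to be discharged.\<close>
  have p4: "(set (X @ ?P) \<turnstile>\<^sub>M {Neg a}) \<in> after ?S d4" if "a \<in> set as" for a
    using 4[THEN conjunct2, rule_format, of X "Neg a"] that by (simp add: Un_commute)
  have "derives (after ?S d4) d5" unfolding d5_def
    by (intro derives_concat_map derives_discharges p4)
  moreover have "(set X \<turnstile>\<^sub>M {imp_chain ?P a}) \<in> after (after ?S d4) d5" if "a \<in> set as" for a
    using derives_discharges(2)[OF p4[OF that]] that unfolding d5_def by auto
  ultimately show ?thesis
    unfolding d using 1 2 3 4 by (simp add: derives_append Un_assoc image_Un)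
qed

section \<open>The closing sequents of ignorable branches\<close>

definition chain_step :: "fm \<Rightarrow> fm list \<Rightarrow> fm list sequent list" where
  "chain_step a u = (case u of [] \<Rightarrow> [] | b # s \<Rightarrow>
     seq [T b, F b] # weakenings [[T b, F b]] (F (Neg a) # map T (b # s)) @
     [seq (T b # T (imp_chain s a) # F (Neg a) # map T s),
      seq (T (imp_chain (b # s) a) # F (Neg a) # map T (b # s))])"

definition chain_part :: "fm list \<Rightarrow> fm \<Rightarrow> fm list sequent list" where
  "chain_part bs a = concat (map (chain_step a) (suffixes bs)) @
     weakenings [[T a, T (Neg a)]] (T (imp_chain bs a) # map T bs) @
     [seq (T a # F (Neg a) # T (imp_chain bs a) # map T bs),
      seq (T a # T (imp_chain bs a) # map T bs)]"

text \<open>The first base closes branches of type 1, the second those of type 2.\<close>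

definition chain_bases :: "fm list \<Rightarrow> fm \<Rightarrow> signed list list" where
  "chain_bases bs a =
     [F (Neg a) # T (imp_chain bs a) # map T bs, T a # T (imp_chain bs a) # map T bs]"

text \<open>Modus ponens along the chain, by one \<open>impL\<close> per premise, derives the
  negation of \<open>a\<close>. This is the first base; cutting that negation against its
  contradiction with \<open>a\<close> yields the second.\<close>

lemma derives_chain_part:
  assumes "set_seq {T (Neg a), F (Neg a)} \<in> S" "set_seq {T a, T (Neg a)} \<in> S"
  shows "derives S (chain_part bs a) \<and>
    (\<forall>b \<in> set (chain_bases bs a). set_seq (set b) \<in> after S (chain_part bs a))"
proof -
  let ?C = "\<lambda>s. set_seq (insert (T (imp_chain s a)) (insert (F (Neg a)) (T ` set s)))"
  have 1: "derives S (concat (map (chain_step a) (suffixes s))) \<and>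
      ?C s \<in> after S (concat (map (chain_step a) (suffixes s)))" for s
  proof (induction s)
    case Nil
    then show ?case using assms(1) by (simp add: chain_step_def imp_chain_def)
  next
    case (Cons b s)
    let ?d = "concat (map (chain_step a) (suffixes s))"
    define w where "w = weakenings [[T b, F b]] (F (Neg a) # map T (b # s))"
    let ?S0 = "insert (set_seq {T b, F b}) (after S ?d)"
    let ?S1 = "after ?S0 w"
    let ?G = "insert (T b) (insert (F (Neg a)) (T ` set s))"
    let ?S2 = "insert (set_seq (insert (T b) (insert (T (imp_chain s a)) (insert (F (Neg a)) (T ` set s))))) ?S1"
    have d: "concat (map (chain_step a) (suffixes (b # s))) = ?d @ seq [T b, F b] # w @
        [seq (T b # T (imp_chain s a) # F (Neg a) # map T s),
         seq (T (imp_chain (b # s) a) # F (Neg a) # map T (b # s))]"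
      by (simp add: chain_step_def w_def)
    have w: "derives ?S0 w" unfolding w_def by (rule derives_weakenings) simp
    have "set_seq (insert (F b) ?G) \<in> ?S1" unfolding w_def
      by (rule weakenings_result[where b = "[T b, F b]"]) auto
    moreover have "mlk True ?S1 (set_seq (insert (T b) (insert (T (imp_chain s a)) (insert (F (Neg a)) (T ` set s)))))"
      using Cons.IH by (intro mlk_weaken) auto
    moreover have "mlk True ?S2 (set_seq (insert (T (Imp b (imp_chain s a))) ?G))"
      by (rule mlk_impL) (use calculation(1) in \<open>auto simp: insert_commute\<close>)
    ultimately show ?case
      using Cons.IH w mlk_ax[of "after S ?d" b] unfolding d
      by (simp add: derives_append imp_chain_def insert_commute)
  qed
  define d1 where "d1 = concat (map (chain_step a) (suffixes bs))"
  define w where "w = weakenings [[T a, T (Neg a)]] (T (imp_chain bs a) # map T bs)"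
  let ?E = "insert (T (imp_chain bs a)) (T ` set bs)"
  let ?S2 = "after (after S d1) w"
  have d: "chain_part bs a = d1 @ w @ [seq (T a # F (Neg a) # T (imp_chain bs a) # map T bs),
      seq (T a # T (imp_chain bs a) # map T bs)]"
    unfolding chain_part_def d1_def w_def ..
  have d1: "derives S d1" "set_seq (insert (F (Neg a)) ?E) \<in> after S d1"
    using 1[of bs] unfolding d1_def by (simp_all add: insert_commute)
  have w: "derives (after S d1) w" unfolding w_def
    by (rule derives_weakenings) (use assms in simp)
  have w': "set_seq (insert (T (Neg a)) (insert (T a) ?E)) \<in> ?S2" unfolding w_def
    by (rule weakenings_result[where b = "[T a, T (Neg a)]"]) (use assms in auto)
  have 2: "mlk True ?S2 (set_seq (insert (T a) (insert (F (Neg a)) ?E)))"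
    using d1(2) by (intro mlk_weaken) auto
  have 3: "mlk True (insert (set_seq (insert (T a) (insert (F (Neg a)) ?E))) ?S2) (set_seq (insert (T a) ?E))"
    by (rule mlk_cut[where s = "T (Neg a)"]) (use w' in \<open>auto simp: insert_commute\<close>)
  show ?thesis
    using d1 w 2 3 unfolding d by (auto simp: derives_append chain_bases_def image_Un)
qed

section \<open>The nodes of a tableau\<close>

text \<open>
  Children are listed before their parents, each node with the formulas needed to get from the
  sequents of its children to its own sequent by cuts.
\<close>

primrec nodes :: "signed list \<Rightarrow> tableau \<Rightarrow> (signed list \<times> signed list) list" where
  "nodes L End = [(L, [])]"
| "nodes L (ExtA i s1 s2 t) = nodes (L @ [s1, s2]) t @ [(L, [opp s2, s1])]"
| "nodes L (ExtB i s1 t1 s2 t2) =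
     nodes (L @ [s2]) t2 @ nodes (L @ [s1]) t1 @ [(L, [s2, opp s1])]"

text \<open>\<open>R\<close> holds the formulas D with sign T; they accompany every branch. The
  suffixes of \<open>snd n\<close> run from the longest to the empty one, so the block ends with the
  sequent of the node itself.\<close>

definition node_part :: "signed list list \<Rightarrow> signed list \<Rightarrow> signed list \<times> signed list
    \<Rightarrow> fm list sequent list" where
  "node_part bs R n = weakenings bs (fst n @ R) @
    map (\<lambda>s. seq (s @ fst n @ R)) (rev (suffixes (snd n)))"

lemma map_fst_expand: "i < length B \<Longrightarrow> map fst (expand i ss B) = map fst B @ ss"
  by (simp add: expand_def map_update comp_def list_update_same_conv)

lemma labels_expand: "i < length B \<Longrightarrow> labels (expand i ss B) = labels B \<union> set ss"
  using map_fst_expand[of i B ss] by (metis set_append set_map)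

lemma nodes_root: "\<exists>e. (L, e) \<in> set (nodes L t)"
  by (cases t) auto

lemma nodes_extend: "(L', e) \<in> set (nodes L t) \<Longrightarrow> set L \<subseteq> set L'"
proof (induction t arbitrary: L)
  case (ExtA i s1 s2 t)
  then show ?case using ExtA.IH[of "L @ [s1, s2]"] by auto
next
  case (ExtB i s1 t1 s2 t2)
  then show ?case using ExtB.IH(1)[of "L @ [s1]"] ExtB.IH(2)[of "L @ [s2]"] by auto
qed simp

lemma branches_nodes:
  "tableau_on B t \<Longrightarrow> B' \<in> branches B t \<Longrightarrow> (map fst B', []) \<in> set (nodes (map fst B) t)"
proof (induction t arbitrary: B)
  case (ExtA i s1 s2 t)
  then show ?case using ExtA.IH[of "expand i [s1, s2] B"] by (simp add: map_fst_expand)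
next
  case (ExtB i s1 t1 s2 t2)
  then show ?case
    using ExtB.IH(1)[of "expand i [s1] B"] ExtB.IH(2)[of "expand i [s2] B"]
    by (auto simp: map_fst_expand)
qed simp

text \<open>Let Q be the labels at a node together with \<open>R\<close>, and s in Q the expanded
  formula. At an \<alpha>-node the child refutes Q, s1, s2, and templates refute Q,
  \<open>opp s2\<close> and Q, \<open>opp s1\<close>; cuts on s2 and then on s1 refute Q. At a
  \<beta>-node the template refutes Q, \<open>opp s1\<close>, \<open>opp s2\<close>; the second
  child removes \<open>opp s2\<close> by a cut, the first one \<open>opp s1\<close>. Weakening
  brings the two premises of each cut to the same side formulas.\<close>

lemma derives_nodes:
  assumes "tableau_on B t"
    and bs: "\<And>b. b \<in> set bs \<Longrightarrow> set_seq (set b) \<in> S" "\<And>b. b \<in> set bs \<Longrightarrow> b \<noteq> []"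
    and alpha: "\<And>s s1 s2. alpha s s1 s2 \<Longrightarrow> {form s1, form s2} \<subseteq> V
      \<Longrightarrow> covered bs {s, opp s1} \<and> covered bs {s, opp s2}"
    and beta: "\<And>s s1 s2. beta s s1 s2 \<Longrightarrow> {form s1, form s2} \<subseteq> V \<Longrightarrow> covered bs {s, opp s1, opp s2}"
    and V: "\<And>L e. (L, e) \<in> set (nodes (map fst B) t) \<Longrightarrow> form ` set L \<subseteq> V"
    and leaves: "\<And>B'. B' \<in> branches B t \<Longrightarrow> \<exists>b \<in> set bs. set b \<subseteq> labels B' \<union> set R"
  shows "derives S (concat (map (node_part bs R) (nodes (map fst B) t))) \<and>
    set_seq (labels B \<union> set R) \<in> lift ` set (concat (map (node_part bs R) (nodes (map fst B) t)))"
  using assms(1) bs(1) V leaves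
proof (induction t arbitrary: B S)
  case End
  let ?w = "weakenings bs (map fst B @ R)"
  have d: "concat (map (node_part bs R) (nodes (map fst B) End)) = ?w @ [seq (map fst B @ R)]"
    by (simp add: node_part_def)
  obtain b where b: "b \<in> set bs" "set b \<subseteq> labels B \<union> set R" using End.prems(4) by auto
  have "set_seq (labels B \<union> set R) \<in> after S ?w"
    by (rule weakenings_result[OF b(1)]) (use b End.prems(2) in auto)
  \<comment> \<open>The sequent of the leaf is already available, and listing it once more must
    again be an inference: a weakening by a formula that it contains. Such a formula exists because
    bases are nonempty.\<close>
  moreover obtain x where "x \<in> labels B \<union> set R"
    using b bs(2) by (meson subsetD list.set_sel(1))
  then have "insert x (labels B \<union> set R) = labels B \<union> set R" by blast
  ultimately have "mlk True (after S ?w) (set_seq (labels B \<union> set R))"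
    using mlk_weaken by metis
  moreover have "derives S ?w" by (rule derives_weakenings) (rule End.prems(2))
  ultimately show ?case unfolding d by (simp add: derives_append image_Un)
next
  case (ExtA i s1 s2 t)
  let ?B1 = "expand i [s1, s2] B" and ?s = "fst (B ! i)"
  let ?d1 = "concat (map (node_part bs R) (nodes (map fst ?B1) t))"
  let ?w = "weakenings bs (map fst B @ R)" and ?Q = "labels B \<union> set R"
  from ExtA.prems(1) have i: "i < length B" and al: "alpha ?s s1 s2" and t: "tableau_on ?B1 t"
    by auto
  have d: "concat (map (node_part bs R) (nodes (map fst B) (ExtA i s1 s2 t))) =
      ?d1 @ ?w @ [seq ([opp s2, s1] @ map fst B @ R), seq ([s1] @ map fst B @ R), seq (map fst B @ R)]"
    using i by (simp add: node_part_def map_fst_expand)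
  have "derives S ?d1 \<and> set_seq (labels ?B1 \<union> set R) \<in> lift ` set ?d1"
  proof (rule ExtA.IH[OF t])
    show "form ` set L \<subseteq> V" if "(L, e) \<in> set (nodes (map fst ?B1) t)" for L e
      by (rule ExtA.prems(3)[of L e]) (use that i in \<open>simp add: map_fst_expand\<close>)
  qed (use ExtA.prems(2,4) in auto)
  then have d1: "derives S ?d1" and "set_seq (labels ?B1 \<union> set R) \<in> after S ?d1" by auto
  then have ch: "set_seq (insert s2 (insert s1 ?Q)) \<in> after S ?d1"
    using i by (simp add: labels_expand insert_commute)
  let ?S = "after (after S ?d1) ?w"
  have w: "derives (after S ?d1) ?w" by (rule derives_weakenings) (use ExtA.prems(2) in auto)
  have s: "?s \<in> ?Q" using i by (auto intro!: imageI)
  obtain e where "(map fst ?B1, e) \<in> set (nodes (map fst ?B1) t)" using nodes_root by blast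
  then have "form ` set (map fst ?B1) \<subseteq> V"
    by (intro ExtA.prems(3)[of "map fst ?B1" e]) (use i in \<open>simp add: map_fst_expand\<close>)
  then have "{form s1, form s2} \<subseteq> V" using i by (auto simp: map_fst_expand)
  then have cov: "covered bs {?s, opp s1}" "covered bs {?s, opp s2}" using alpha[OF al] by auto
  have wk: "set_seq (insert x ?Q) \<in> ?S" if "covered bs {?s, x}" for x
  proof -
    from that obtain b where b: "b \<in> set bs" "set b = {?s, x}" unfolding covered_def by blast
    show ?thesis
      by (rule weakenings_result[OF b(1)]) (use b s ExtA.prems(2)[OF b(1)] in auto)
  qed
  let ?q1 = "set_seq (insert (opp s2) (insert s1 ?Q))" and ?q2 = "set_seq (insert s1 ?Q)"
  have "mlk True ?S ?q1"
    using mlk_weaken[OF wk[OF cov(2)], of s1] by (simp add: insert_commute)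
  moreover have "mlk True (insert ?q1 ?S) ?q2"
    by (rule mlk_cut[where s = s2]) (use ch in auto)
  moreover have "mlk True (insert ?q2 (insert ?q1 ?S)) (set_seq ?Q)"
    by (rule mlk_cut[where s = s1]) (use wk[OF cov(1)] in auto)
  ultimately show ?case
    using d1 w unfolding d by (simp add: derives_append image_Un Un_assoc)
next
  case (ExtB i s1 t1 s2 t2)
  let ?B1 = "expand i [s1] B" and ?B2 = "expand i [s2] B" and ?s = "fst (B ! i)"
  let ?d1 = "concat (map (node_part bs R) (nodes (map fst ?B1) t1))"
  let ?d2 = "concat (map (node_part bs R) (nodes (map fst ?B2) t2))"
  let ?w = "weakenings bs (map fst B @ R)" and ?Q = "labels B \<union> set R"
  from ExtB.prems(1) have i: "i < length B" and be: "beta ?s s1 s2"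
    and t: "tableau_on ?B1 t1" "tableau_on ?B2 t2" by auto
  have d: "concat (map (node_part bs R) (nodes (map fst B) (ExtB i s1 t1 s2 t2))) =
      ?d2 @ ?d1 @ ?w @ [seq ([s2, opp s1] @ map fst B @ R), seq ([opp s1] @ map fst B @ R), seq (map fst B @ R)]"
    using i by (simp add: node_part_def map_fst_expand)
  have "derives S ?d2 \<and> set_seq (labels ?B2 \<union> set R) \<in> lift ` set ?d2"
  proof (rule ExtB.IH(2)[OF t(2)])
    show "form ` set L \<subseteq> V" if "(L, e) \<in> set (nodes (map fst ?B2) t2)" for L e
      by (rule ExtB.prems(3)[of L e]) (use that i in \<open>simp add: map_fst_expand\<close>)
  qed (use ExtB.prems(2,4) in auto)
  then have d2: "derives S ?d2" and "set_seq (labels ?B2 \<union> set R) \<in> after S ?d2" by auto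
  then have ch2: "set_seq (insert s2 ?Q) \<in> after S ?d2"
    using i by (simp add: labels_expand)
  have "derives (after S ?d2) ?d1 \<and> set_seq (labels ?B1 \<union> set R) \<in> lift ` set ?d1"
  proof (rule ExtB.IH(1)[OF t(1)])
    show "form ` set L \<subseteq> V" if "(L, e) \<in> set (nodes (map fst ?B1) t1)" for L e
      by (rule ExtB.prems(3)[of L e]) (use that i in \<open>simp add: map_fst_expand\<close>)
  qed (use ExtB.prems(2,4) in auto)
  then have d1: "derives (after S ?d2) ?d1"
    and "set_seq (labels ?B1 \<union> set R) \<in> after (after S ?d2) ?d1" by auto
  then have ch1: "set_seq (insert s1 ?Q) \<in> after (after S ?d2) ?d1"
    using i by (simp add: labels_expand)
  let ?S = "after (after (after S ?d2) ?d1) ?w"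
  have w: "derives (after (after S ?d2) ?d1) ?w"
    by (rule derives_weakenings) (use ExtB.prems(2) in auto)
  have s: "?s \<in> ?Q" using i by (auto intro!: imageI)
  obtain e1 e2 where "(map fst ?B1, e1) \<in> set (nodes (map fst ?B1) t1)"
    "(map fst ?B2, e2) \<in> set (nodes (map fst ?B2) t2)" using nodes_root by blast
  then have "form ` set (map fst ?B1) \<subseteq> V" "form ` set (map fst ?B2) \<subseteq> V"
    using ExtB.prems(3)[of "map fst ?B1" e1] ExtB.prems(3)[of "map fst ?B2" e2] i
    by (simp_all add: map_fst_expand)
  then have "{form s1, form s2} \<subseteq> V" using i by (auto simp: map_fst_expand)
  then obtain b where b: "b \<in> set bs" "set b = {?s, opp s1, opp s2}"
    using beta[OF be] unfolding covered_def by auto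
  have wk: "set_seq (insert (opp s1) (insert (opp s2) ?Q)) \<in> ?S"
    by (rule weakenings_result[OF b(1)]) (use b s ExtB.prems(2)[OF b(1)] in auto)
  let ?q1 = "set_seq (insert s2 (insert (opp s1) ?Q))" and ?q2 = "set_seq (insert (opp s1) ?Q)"
  have "set_seq (insert s2 ?Q) \<in> ?S" using ch2 by blast
  from mlk_weaken[OF this, of "opp s1"] have "mlk True ?S ?q1" by (simp add: insert_commute)
  moreover have "mlk True (insert ?q1 ?S) ?q2"
    by (rule mlk_cut[where s = s2]) (use wk in \<open>auto simp: insert_commute\<close>)
  moreover have "mlk True (insert ?q2 (insert ?q1 ?S)) (set_seq ?Q)"
    by (rule mlk_cut[where s = s1]) (use ch1 in auto)
  ultimately show ?case
    using d1 d2 w unfolding d by (simp add: derives_append image_Un Un_assoc)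
qed

section \<open>Completed branches are saturated\<close>

text \<open>An invariant of branches: the components of a marked node lie further down. The position
  matters, since saturation derives a formula only from later ones, which keeps the climb towards
  the root well-founded.\<close>

definition expanded :: "fm set \<Rightarrow> branch \<Rightarrow> bool" where
  "expanded V B \<longleftrightarrow> (\<forall>i < length B. snd (B ! i) \<longrightarrow>
     (\<exists>s1 s2. form s1 \<in> V \<and> form s2 \<in> V \<and>
       (alpha (fst (B ! i)) s1 s2 \<and> {s1, s2} \<subseteq> labels (drop (Suc i) B) \<or>
        beta (fst (B ! i)) s1 s2 \<and> {s1, s2} \<inter> labels (drop (Suc i) B) \<noteq> {})))"

lemma nth_expand:
  "i < length B \<Longrightarrow> j < length B \<Longrightarrow> expand i ss B ! j = (if j = i then (fst (B ! i), True) else B ! j)"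
  by (simp add: expand_def nth_append)

lemma labels_drop_expand:
  assumes "i < length B" "j < length B"
  shows "labels (drop (Suc j) (expand i ss B)) = labels (drop (Suc j) B) \<union> set ss"
proof -
  have "map fst (drop (Suc j) (expand i ss B)) = map fst (drop (Suc j) B) @ ss"
    using assms by (simp add: drop_map[symmetric] map_fst_expand)
  then show ?thesis by (metis set_append set_map)
qed

lemma expanded_expand:
  assumes "expanded V B" "i < length B" "form s1 \<in> V" "form s2 \<in> V"
    and "alpha (fst (B ! i)) s1 s2 \<and> {s1, s2} \<subseteq> set ss \<or>
      beta (fst (B ! i)) s1 s2 \<and> {s1, s2} \<inter> set ss \<noteq> {}"
  shows "expanded V (expand i ss B)"
  unfolding expanded_def
proof (intro allI impI)
  fix j assume j: "j < length (expand i ss B)" "snd (expand i ss B ! j)"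
  have jB: "j < length B"
  proof (rule ccontr)
    assume "\<not> j < length B"
    then show False using j by (simp add: expand_def nth_append)
  qed
  show "\<exists>s1 s2. form s1 \<in> V \<and> form s2 \<in> V \<and>
      (alpha (fst (expand i ss B ! j)) s1 s2 \<and> {s1, s2} \<subseteq> labels (drop (Suc j) (expand i ss B)) \<or>
       beta (fst (expand i ss B ! j)) s1 s2 \<and> {s1, s2} \<inter> labels (drop (Suc j) (expand i ss B)) \<noteq> {})"
  proof (cases "j = i")
    case True
    then show ?thesis using assms(2-5) jB unfolding labels_drop_expand[OF assms(2) jB]
      by (intro exI[of _ s1] exI[of _ s2]) (auto simp: nth_expand)
  next
    case False
    then have "snd (B ! j)" using j(2) assms(2) jB by (simp add: nth_expand)
    from assms(1)[unfolded expanded_def, rule_format, OF jB this]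
    obtain r1 r2 where "form r1 \<in> V" "form r2 \<in> V"
       "alpha (fst (B ! j)) r1 r2 \<and> {r1, r2} \<subseteq> labels (drop (Suc j) B) \<or>
        beta (fst (B ! j)) r1 r2 \<and> {r1, r2} \<inter> labels (drop (Suc j) B) \<noteq> {}"
      by blast
    then show ?thesis using False assms(2) jB unfolding labels_drop_expand[OF assms(2) jB]
      by (intro exI[of _ r1] exI[of _ r2]) (auto simp: nth_expand)
  qed
qed

lemma expanded_branches:
  assumes "expanded V B" "tableau_on B t" "B' \<in> branches B t"
    and "\<And>L e. (L, e) \<in> set (nodes (map fst B) t) \<Longrightarrow> form ` set L \<subseteq> V"
  shows "expanded V B'"
  using assms
proof (induction t arbitrary: B)
  case (ExtA i s1 s2 t)
  let ?B1 = "expand i [s1, s2] B"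
  from ExtA.prems(2) have i: "i < length B" and al: "alpha (fst (B ! i)) s1 s2" and t: "tableau_on ?B1 t"
    by auto
  have V: "form ` set L \<subseteq> V" if "(L, e) \<in> set (nodes (map fst ?B1) t)" for L e
    by (rule ExtA.prems(4)[of L e]) (use that i in \<open>simp add: map_fst_expand\<close>)
  obtain e where "(map fst ?B1, e) \<in> set (nodes (map fst ?B1) t)" using nodes_root by blast
  from V[OF this] have "form s1 \<in> V" "form s2 \<in> V" using i by (auto simp: map_fst_expand)
  then have "expanded V ?B1"
    using al by (intro expanded_expand[OF ExtA.prems(1) i, of s1 s2]) auto
  then show ?case using ExtA.prems(3) t V by (intro ExtA.IH) auto
next
  case (ExtB i s1 t1 s2 t2)
  let ?B1 = "expand i [s1] B" and ?B2 = "expand i [s2] B"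
  from ExtB.prems(2) have i: "i < length B" and be: "beta (fst (B ! i)) s1 s2"
    and t: "tableau_on ?B1 t1" "tableau_on ?B2 t2"
    by auto
  have V1: "form ` set L \<subseteq> V" if "(L, e) \<in> set (nodes (map fst ?B1) t1)" for L e
    by (rule ExtB.prems(4)[of L e]) (use that i in \<open>simp add: map_fst_expand\<close>)
  have V2: "form ` set L \<subseteq> V" if "(L, e) \<in> set (nodes (map fst ?B2) t2)" for L e
    by (rule ExtB.prems(4)[of L e]) (use that i in \<open>simp add: map_fst_expand\<close>)
  obtain e1 e2 where "(map fst ?B1, e1) \<in> set (nodes (map fst ?B1) t1)"
    "(map fst ?B2, e2) \<in> set (nodes (map fst ?B2) t2)" using nodes_root by blast
  from V1[OF this(1)] V2[OF this(2)] have "form s1 \<in> V" "form s2 \<in> V"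
    using i by (auto simp: map_fst_expand)
  then have ex: "expanded V (expand i [s] B)" if "s \<in> {s1, s2}" for s
    using be that by (intro expanded_expand[OF ExtB.prems(1) i, of s1 s2]) auto
  from ExtB.prems(3) consider "B' \<in> branches ?B1 t1" | "B' \<in> branches ?B2 t2" by auto
  then show ?case
  proof cases
    case 1
    show ?thesis by (rule ExtB.IH(1)[OF ex t(1) 1 V1]) simp_all
  next
    case 2
    show ?thesis by (rule ExtB.IH(2)[OF ex t(2) 2 V2]) simp_all
  qed
qed simp

lemma suffix_true_formsE:
  assumes "suffix (A # s) (true_forms L)"
  obtains L1 L2 where "L = L1 @ T A # L2" "s = true_forms L2"
  using assms
proof (induction L arbitrary: thesis)
  case Nil
  then show ?case by (simp add: true_forms_def)
next
  case (Cons x L)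
  show ?case
  proof (cases "suffix (A # s) (true_forms L)")
    case True
    then obtain L1 L2 where "L = L1 @ T A # L2" "s = true_forms L2" using Cons.IH by blast
    then show ?thesis using Cons.prems(1)[of "x # L1" L2] by simp
  next
    case False
    with Cons.prems(2) have "x = T A" "s = true_forms L"
      by (auto simp: true_forms_def suffix_Cons split: if_splits)
    then show ?thesis using Cons.prems(1)[of "[]" L] by simp
  qed
qed

text \<open>An unmarked node is a literal and follows from itself; a negative one counts as a
  literal of the model because the branch is not \<open>T\<close>-closed. A marked node follows from
  its components, which stand later on the branch.\<close>

lemma saturated_if_completed:
  assumes compl: "completed B" "\<not> T_closed B" and "expanded V B"
    and V: "\<And>A. A \<in> V \<Longrightarrow> A \<in> set U \<and> strip A \<in> set U" and forms: "form ` labels B \<subseteq> V"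
  shows "saturated (all_templates U) (map fst B)"
  unfolding saturated_def
proof
  let ?L = "map fst B"
  fix u assume "u \<in> set (suffixes (true_forms ?L))"
  then have u: "suffix u (true_forms ?L)" by simp
  show "case u of [] \<Rightarrow> True | A # s \<Rightarrow> \<exists>b \<in> set (all_templates U). \<forall>x \<in> set b.
      x \<in> set (F A # map T (true_atoms ?L @ s @ false_atoms ?L))"
  proof (cases u)
    case (Cons A s)
    let ?R = "set (F A # map T (true_atoms ?L @ s @ false_atoms ?L))"
    obtain L1 L2 where L: "?L = L1 @ T A # L2" and s: "s = true_forms L2"
      using u Cons by (auto elim: suffix_true_formsE)
    define i where "i = length L1"
    have i: "i < length B" "fst (B ! i) = T A" "map fst (drop (Suc i) B) = L2"
    proof -
      have "length B = length ?L" by simp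
      then show "i < length B" unfolding L i_def by simp
      then have "fst (B ! i) = ?L ! i" by simp
      then show "fst (B ! i) = T A" unfolding L i_def by simp
      show "map fst (drop (Suc i) B) = L2" unfolding drop_map[symmetric] L i_def by simp
    qed
    then have lab: "labels (drop (Suc i) B) = set L2" by (metis set_map)
    have TA: "T A \<in> labels B" using i by (metis image_eqI nth_mem)
    have "\<exists>S. covered (all_templates U) S \<and> S \<subseteq> ?R"
    proof (cases "snd (B ! i)")
      case False
      then have lit: "literal A" using compl(1) i unfolding completed_def
        by (metis (mono_tags, lifting) case_prodD nth_mem prod.collapse signed.sel(1))
      have "A \<in> set U" using V forms TA by force
      then have "covered (all_templates U) {T A, F A}"
        by (intro covered_if_template[of A U A]) (auto simp: templates_def)
      moreover have "A \<in> set (true_atoms ?L) \<union> set (false_atoms ?L)"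
      proof (cases "is_atom A")
        case True
        then show ?thesis using TA by (simp add: true_atoms_def)
      next
        case False
        with lit obtain p where A: "A = Neg (Atom p)"
          by (cases A rule: literal.cases) (auto simp: is_atom_def)
        then have "T (Atom p) \<notin> labels B" using compl(2) TA unfolding T_closed_def by blast
        then show ?thesis using TA A by (simp add: false_atoms_def true_atoms_def is_atom_def)
      qed
      ultimately show ?thesis by (intro exI[of _ "{T A, F A}"]) auto
    next
      case True
      then obtain s1 s2 where "form s1 \<in> V" "form s2 \<in> V"
        and rule: "alpha (T A) s1 s2 \<and> {s1, s2} \<subseteq> set L2 \<or> beta (T A) s1 s2 \<and> {s1, s2} \<inter> set L2 \<noteq> {}"
        using assms(3) i lab unfolding expanded_def by metis
      then have U: "{form s1, strip (form s1), form s2, strip (form s2)} \<subseteq> set U" using V by blast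
      \<comment> \<open>Rules for formulas with sign T have only components with sign T, so these
        occur among the true formulas.\<close>
      have s12: "s1 = T (form s1)" "s2 = T (form s2)"
        using rule by (auto elim: alpha.cases beta.cases)
      have in_s: "x \<in> ?R" if "x \<in> set L2" "x = T (form x)" for x
      proof -
        have "form x \<in> set s" using that unfolding s by simp
        then show ?thesis using that(2) by (metis UnCI image_eqI list.set_intros(2) set_append set_map)
      qed
      from rule show ?thesis
      proof (elim disjE conjE)
        assume "alpha (T A) s1 s2" "{s1, s2} \<subseteq> set L2"
        then show ?thesis
          using covered_alpha(3)[OF _ U, of "T A"] in_s[of s1] in_s[of s2] s12
          by (intro exI[of _ "{F A, s1, s2}"]) auto
      next
        assume be: "beta (T A) s1 s2" "{s1, s2} \<inter> set L2 \<noteq> {}"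
        then consider "s1 \<in> set L2" | "s2 \<in> set L2" by blast
        then show ?thesis
        proof cases
          case 1
          then show ?thesis using covered_beta(2)[OF be(1) U] in_s[of s1] s12
            by (intro exI[of _ "{F A, s1}"]) auto
        next
          case 2
          then show ?thesis using covered_beta(3)[OF be(1) U] in_s[of s2] s12
            by (intro exI[of _ "{F A, s2}"]) auto
        qed
      qed
    qed
    then show ?thesis unfolding Cons list.case covered_def by blast
  qed simp
qed

section \<open>The derivation for a tableau\<close>

definition universe :: "(signed list \<times> signed list) list \<Rightarrow> fm list" where
  "universe ns = concat (map (\<lambda>n. concat (map (\<lambda>s. [form s, strip (form s)]) (fst n))) ns)"

text \<open>An inner node passes the filter too if its labels are saturated. This is harmless,
  because all that is derived from such a list rests on saturation and on the labels of the
  root.\<close>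

definition models :: "(signed list \<times> signed list) list \<Rightarrow> signed list list" where
  "models ns = filter (saturated (all_templates (universe ns))) (map fst ns)"

text \<open>Every known atom outside the model is taken, so it need not be determined which atom
  ignores which branch; the number of pairs stays polynomial.\<close>

definition candidates :: "(signed list \<times> signed list) list \<Rightarrow> signed list \<Rightarrow> fm list" where
  "candidates ns L = filter (\<lambda>a. is_atom a \<and> a \<notin> set (true_atoms L)) (universe ns)"

text \<open>The pairs \<open>(M, a)\<close> for which \<open>M \<rightarrow> \<not> a\<close> is used as a lemma.\<close>

definition exclusions :: "(signed list \<times> signed list) list \<Rightarrow> (fm list \<times> fm) list" where
  "exclusions ns = concat (map (\<lambda>L. map (\<lambda>a. (true_atoms L, a)) (candidates ns L)) (models ns))"

definition lemma_forms :: "(signed list \<times> signed list) list \<Rightarrow> fm list" where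
  "lemma_forms ns = map (\<lambda>p. imp_chain (fst p) (snd p)) (exclusions ns)"

definition closing :: "(signed list \<times> signed list) list \<Rightarrow> signed list list" where
  "closing ns = all_templates (universe ns) @
     concat (map (\<lambda>p. chain_bases (fst p) (snd p)) (exclusions ns))"

definition derivation :: "fm list \<Rightarrow> fm list \<Rightarrow> (signed list \<times> signed list) list \<Rightarrow> fm list sequent list" where
  "derivation X Y ns =
     map seq (all_templates (universe ns)) @
     concat (map (\<lambda>L. model_part (all_templates (universe ns)) X (candidates ns L) L) (models ns)) @
     grid X (lemma_forms ns) (lemma_forms ns) @
     concat (map (\<lambda>p. chain_part (fst p) (snd p)) (exclusions ns)) @
     concat (map (node_part (closing ns) (map T (lemma_forms ns))) ns) @
     cuts X (lemma_forms ns) Y"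

lemma set_universe: "(L, e) \<in> set ns \<Longrightarrow> s \<in> set L \<Longrightarrow> {form s, strip (form s)} \<subseteq> set (universe ns)"
  unfolding universe_def set_concat set_map by (intro insert_subsetI; force)

text \<open>Closed branches contain a template. A branch of type 1 serves as its own model, with the
  atom of its \<open>F\<close>-signed negation, which the universe contains through
  \<open>strip\<close>. For type 2 the smaller branch is the model, and its atoms are available
  because they are true on the larger branch.\<close>

lemma leaf_covered:
  assumes otab: "otab_proof X Y t" and ns: "ns = nodes (map fst (initial_branch X Y)) t"
    and B: "B \<in> branches (initial_branch X Y) t"
  shows "\<exists>b \<in> set (closing ns). set b \<subseteq> labels B \<union> set (map T (lemma_forms ns))"
proof -
  let ?B0 = "initial_branch X Y" and ?U = "universe ns" and ?Ds = "set (map T (lemma_forms ns))"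
  define V where "V = {A. A \<in> set ?U \<and> strip A \<in> set ?U}"
  from otab have tab: "tableau_on ?B0 t" unfolding otab_proof_def by blast
  have V: "form ` set L \<subseteq> V" if "(L, e) \<in> set ns" for L e
    using set_universe[OF that] unfolding V_def by auto
  have leaf: "(map fst B', []) \<in> set ns" if "B' \<in> branches ?B0 t" for B'
    using branches_nodes[OF tab that] ns by simp
  have form_V: "form x \<in> V" if "x \<in> labels B'" "B' \<in> branches ?B0 t" for x B'
    using V[OF leaf[OF that(2)]] that(1) by auto
  have template: ?thesis if "A \<in> V" "b \<in> set (templates A A)" "set b \<subseteq> labels B" for A b
  proof -
    have "b \<in> set (closing ns)"
      using that(1,2) all_templatesI[of A ?U A b] unfolding closing_def V_def by auto
    then show ?thesis using that(3) by blast
  qed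
  have model: "map fst B' \<in> set (models ns)"
    if B': "B' \<in> branches ?B0 t" "completed B'" "\<not> T_closed B'" for B'
  proof -
    have "expanded V ?B0"
      unfolding expanded_def initial_branch_def by (auto simp: nth_append)
    then have "expanded V B'"
      using expanded_branches[OF _ tab B'(1)] V ns by blast
    moreover have "form ` labels B' \<subseteq> V" using form_V[OF _ B'(1)] by blast
    ultimately have "saturated (all_templates ?U) (map fst B')"
      by (intro saturated_if_completed[where V = V] B') (simp_all add: V_def)
    then show ?thesis using leaf[OF B'(1)] unfolding models_def by force
  qed
  have chain: ?thesis
    if B': "B' \<in> branches ?B0 t" "completed B'" "\<not> T_closed B'" and sub: "At B' \<subseteq> At B"
      and a: "Atom a \<in> set ?U" "a \<notin> At B'"
      and x: "F (Neg (Atom a)) \<in> labels B \<or> T (Atom a) \<in> labels B" for B' a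
  proof -
    let ?P = "true_atoms (map fst B')"
    have P: "A \<in> set ?P \<longleftrightarrow> (\<exists>p. A = Atom p \<and> p \<in> At B')" for A
      by (auto simp: true_atoms_def is_atom_def At_def)
    have "Atom a \<in> set (candidates ns (map fst B'))"
      using a P unfolding candidates_def by (auto simp: is_atom_def)
    then have pair: "(?P, Atom a) \<in> set (exclusions ns)"
      using model[OF B'] unfolding exclusions_def by auto
    then have D: "imp_chain ?P (Atom a) \<in> set (lemma_forms ns)"
      unfolding lemma_forms_def by force
    have TP: "T A \<in> labels B" if A: "A \<in> set ?P" for A
    proof -
      obtain p where "A = Atom p" "p \<in> At B'" using A P by blast
      then show ?thesis using sub unfolding At_def by blast
    qed
    from x obtain y where y: "y = F (Neg (Atom a)) \<or> y = T (Atom a)" "y \<in> labels B" by blast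
    define b where "b = y # T (imp_chain ?P (Atom a)) # map T ?P"
    have "b \<in> set (chain_bases ?P (Atom a))"
      using y(1) unfolding b_def chain_bases_def by auto
    moreover have "set b \<subseteq> labels B \<union> ?Ds"
      using y(2) D TP unfolding b_def by (simp only: list.set set_map) blast
    moreover have "set (chain_bases ?P (Atom a)) \<subseteq> set (closing ns)"
      using pair unfolding closing_def by force
    ultimately show ?thesis by blast
  qed
  \<comment> \<open>A branch of type 1 that is also \<open>T\<close>-closed goes to the first case,
    so in the second one the branch qualifies as a model.\<close>
  consider "closed_branch B" | "ignorable1 B" "\<not> T_closed B" | "ignorable2 (branches ?B0 t) B"
    using otab B unfolding otab_proof_def closed_branch_def by blast
  then show ?thesis
  proof cases
    case 1
    then consider A where "T A \<in> labels B" "T (Neg A) \<in> labels B"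
      | A where "F A \<in> labels B" "F (Neg A) \<in> labels B"
      | A where "T A \<in> labels B" "F A \<in> labels B"
      unfolding closed_branch_def T_closed_def F_closed_def TF_closed_def by blast
    then show ?thesis
    proof cases
      case (1 A)
      then show ?thesis using form_V[of "T A" B] B
        by (intro template[of A "[T (Neg A), T A]"]) (auto simp: templates_def)
    next
      case (2 A)
      then show ?thesis using form_V[of "F A" B] B
        by (intro template[of A "[F (Neg A), F A]"]) (auto simp: templates_def)
    next
      case (3 A)
      then show ?thesis using form_V[of "T A" B] B
        by (intro template[of A "[T A, F A]"]) (auto simp: templates_def)
    qed
  next
    case 2
    then obtain a where a: "completed B" "F (Neg (Atom a)) \<in> labels B" "T (Atom a) \<notin> labels B"
      unfolding ignorable1_def by blast
    then show ?thesis
      using chain[OF B a(1) 2(2), of a] form_V[OF a(2) B] unfolding V_def At_def by auto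
  next
    case 3
    then obtain B' where B': "B' \<in> branches ?B0 t" "completed B'" "\<not> T_closed B'" "At B' \<subset> At B"
      unfolding ignorable2_def by blast
    then obtain a where a: "a \<in> At B" "a \<notin> At B'" by blast
    then show ?thesis
      using chain[OF B'(1-3), of a] B'(4) form_V[of "T (Atom a)" B] B unfolding V_def At_def by auto
  qed
qed

lemma derives_derivation:
  assumes otab: "otab_proof X Y t" and ns: "ns = nodes (map fst (initial_branch X Y)) t"
  shows "derives {} (derivation X Y ns)"
proof -
  let ?B0 = "initial_branch X Y"
  from otab have tab: "tableau_on ?B0 t" unfolding otab_proof_def by blast
  define bs where "bs = all_templates (universe ns)"
  define Ds where "Ds = lemma_forms ns"
  define d1 where "d1 = map seq bs"
  define d2 where "d2 = concat (map (\<lambda>L. model_part bs X (candidates ns L) L) (models ns))"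
  define d3 where "d3 = grid X Ds Ds"
  define d4 where "d4 = concat (map (\<lambda>p. chain_part (fst p) (snd p)) (exclusions ns))"
  define d5 where "d5 = concat (map (node_part (closing ns) (map T Ds)) ns)"
  define d6 where "d6 = cuts X Ds Y"
  define S1 where "S1 = lift ` set d1"
  define S2 where "S2 = after S1 d2"
  define S3 where "S3 = after S2 d3"
  define S4 where "S4 = after S3 d4"
  define S5 where "S5 = after S4 d5"
  have d: "derivation X Y ns = d1 @ d2 @ d3 @ d4 @ d5 @ d6"
    unfolding derivation_def d1_def d2_def d3_def d4_def d5_def d6_def bs_def Ds_def ..
  have 1: "derives {} d1" unfolding d1_def bs_def by (rule derives_all_templates)
  have bs: "set_seq (set b) \<in> S1" if "b \<in> set bs" for b
  proof -
    have "lift (seq b) \<in> S1" using that unfolding S1_def d1_def by (intro imageI) simp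
    then show ?thesis by simp
  qed
  have model: "derives S1 (model_part bs X (candidates ns L) L) \<and>
      (\<forall>a \<in> set (candidates ns L). (set X \<turnstile>\<^sub>M {imp_chain (true_atoms L) a})
        \<in> after S1 (model_part bs X (candidates ns L) L))" if L: "L \<in> set (models ns)" for L
  proof (rule derives_model_part)
    obtain e where "(L, e) \<in> set ns" using L unfolding models_def by auto
    then have "set (map fst ?B0) \<subseteq> set L" using nodes_extend ns by blast
    then show "set X \<subseteq> set (true_forms L)" by (auto simp: initial_branch_def)
    show "saturated bs L" using L unfolding models_def bs_def by simp
    show "is_atom a \<and> a \<notin> set (true_atoms L)" if "a \<in> set (candidates ns L)" for a
      using that unfolding candidates_def by simp
  qed (rule bs)
  have 2: "derives S1 d2" unfolding d2_def
    by (rule derives_concat_map) (use model in blast)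
  have Ds: "(set X \<turnstile>\<^sub>M {D}) \<in> S2" if "D \<in> set Ds" for D
  proof -
    from that obtain L a where L: "L \<in> set (models ns)" and a: "a \<in> set (candidates ns L)"
      and D: "D = imp_chain (true_atoms L) a"
      unfolding Ds_def lemma_forms_def exclusions_def by auto
    have "(set X \<turnstile>\<^sub>M {D}) \<in> after S1 (model_part bs X (candidates ns L) L)"
      using model[OF L] a D by blast
    moreover have "set (model_part bs X (candidates ns L) L) \<subseteq> set d2"
      using L unfolding d2_def by auto
    ultimately show ?thesis unfolding S2_def by auto
  qed
  \<comment> \<open>The lemmas are so far derived over \<open>X\<close> alone, but the cut of one of
    them happens while others are still on the left; the grid supplies these contexts.\<close>
  have 3: "derives S2 d3 \<and>
      (\<forall>s A. suffix s Ds \<longrightarrow> A \<in> set Ds \<longrightarrow> (set (X @ s) \<turnstile>\<^sub>M {A}) \<in> S3)"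
    unfolding d3_def S3_def by (rule derives_grid) (use Ds in auto)
  have chain: "derives S3 (chain_part (fst p) (snd p)) \<and>
    (\<forall>b \<in> set (chain_bases (fst p) (snd p)). set_seq (set b) \<in> after S3 (chain_part (fst p) (snd p)))"
    if p: "p \<in> set (exclusions ns)" for p
  proof (rule derives_chain_part)
    have "snd p \<in> set (universe ns)"
      using p unfolding exclusions_def candidates_def by auto
    then have "[F (Neg (snd p)), T (Neg (snd p))] \<in> set bs" "[T (Neg (snd p)), T (snd p)] \<in> set bs"
      unfolding bs_def by (auto intro!: all_templatesI simp: templates_def)
    from this[THEN bs] show "set_seq {T (Neg (snd p)), F (Neg (snd p))} \<in> S3"
      "set_seq {T (snd p), T (Neg (snd p))} \<in> S3"
      unfolding S3_def S2_def by (auto simp: insert_commute)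
  qed
  have 4: "derives S3 d4" unfolding d4_def
    by (rule derives_concat_map) (use chain in blast)
  have closing: "set_seq (set b) \<in> S4 \<and> b \<noteq> []" if b: "b \<in> set (closing ns)" for b
  proof -
    from b consider "b \<in> set bs" | p where "p \<in> set (exclusions ns)" "b \<in> set (chain_bases (fst p) (snd p))"
      unfolding closing_def bs_def by auto
    then show ?thesis
    proof cases
      case 1
      then obtain A B where "b \<in> set (templates A B)" unfolding bs_def all_templates_def by auto
      then have "b \<noteq> []" unfolding templates_def by auto
      then show ?thesis using bs[OF 1] unfolding S4_def S3_def S2_def by blast
    next
      case 2
      then have "set_seq (set b) \<in> after S3 (chain_part (fst p) (snd p))" using chain by blast
      moreover have "set (chain_part (fst p) (snd p)) \<subseteq> set d4" using 2(1) unfolding d4_def by auto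
      ultimately show ?thesis using 2(2) unfolding S4_def chain_bases_def by auto
    qed
  qed
  define V where "V = {A. A \<in> set (universe ns) \<and> strip A \<in> set (universe ns)}"
  have covered: "covered (closing ns) S" if "covered bs S" for S
    using that unfolding covered_def closing_def bs_def by auto
  have "derives S4 (concat (map (node_part (closing ns) (map T Ds)) (nodes (map fst ?B0) t))) \<and>
      set_seq (labels ?B0 \<union> set (map T Ds))
        \<in> lift ` set (concat (map (node_part (closing ns) (map T Ds)) (nodes (map fst ?B0) t)))"
  proof (rule derives_nodes[where V = V, OF tab])
    show "covered (closing ns) {s, opp s1} \<and> covered (closing ns) {s, opp s2}"
      if "alpha s s1 s2" "{form s1, form s2} \<subseteq> V" for s s1 s2
      using covered_alpha[OF that(1), of "universe ns"] that(2)
      unfolding V_def by (auto intro!: covered simp: bs_def)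
    show "covered (closing ns) {s, opp s1, opp s2}"
      if "beta s s1 s2" "{form s1, form s2} \<subseteq> V" for s s1 s2
      using covered_beta[OF that(1), of "universe ns"] that(2)
      unfolding V_def by (auto intro!: covered simp: bs_def)
    show "form ` set L \<subseteq> V" if "(L, e) \<in> set (nodes (map fst ?B0) t)" for L e
      using set_universe[of L e ns] that ns unfolding V_def by auto
    show "\<exists>b \<in> set (closing ns). set b \<subseteq> labels B \<union> set (map T Ds)"
      if "B \<in> branches ?B0 t" for B
      using leaf_covered[OF otab ns that] unfolding Ds_def .
  qed (use closing in auto)
  then have 5: "derives S4 d5 \<and> set_seq (labels ?B0 \<union> set (map T Ds)) \<in> lift ` set d5"
    unfolding d5_def ns[symmetric] .
  \<comment> \<open>The root of the tableau is the sequent to be proved, with the formulas D added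
    on the left.\<close>
  have "set_seq (labels ?B0 \<union> set (map T Ds)) = (set (X @ Ds) \<turnstile> set Y)"
    by (auto simp: set_seq_def initial_branch_def image_Un image_image image_iff)
  then have "(set (X @ Ds) \<turnstile> set Y) \<in> S5" using 5 unfolding S5_def by auto
  then have "mlk True S5 (set (X @ Ds) \<turnstile>\<^sub>M set Y)" by (rule M_lk)
  moreover have "(set (X @ s) \<turnstile>\<^sub>M {A}) \<in> S5" if "suffix (A # s) Ds" for A s
  proof -
    have "A \<in> set Ds" using set_mono_suffix[OF that] by simp
    then have "(set (X @ s) \<turnstile>\<^sub>M {A}) \<in> S3" using 3 suffix_ConsD[OF that] by blast
    then show ?thesis unfolding S5_def S4_def by blast
  qed
  ultimately have "derives S5 d6" unfolding d6_def by (intro derives_cuts[THEN conjunct1])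
  with 1 2 3 4 5 show ?thesis unfolding d
    by (simp add: derives_append S1_def S2_def S3_def S4_def S5_def)
qed

text \<open>A proof must end in the given lists, not merely in the same sets; the last cut leaves
  the empty suffix, and \<open>X @ []\<close> is \<open>X\<close>.\<close>

lemma last_derivation: "derivation X Y ns \<noteq> [] \<and> last (derivation X Y ns) = (X \<turnstile>\<^sub>M Y)"
proof -
  have "cuts X (lemma_forms ns) Y \<noteq> []" by (simp add: cuts_def)
  moreover have "last (cuts X (lemma_forms ns) Y) = (X \<turnstile>\<^sub>M Y)"
    by (simp add: cuts_def last_map last_rev)
  ultimately show ?thesis by (simp add: derivation_def)
qed

section \<open>Computing the derivation in polynomial time\<close>

text \<open>A class instance has to cover all component types, whereas \<open>enc_sequent\<close> is
  fixed to lists of formulas; the two agree there by \<open>enc_sequent_eq\<close>.\<close>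

instantiation sequent :: (encodable) encodable
begin
primrec enc_sequent' :: "'a sequent \<Rightarrow> data" where
  "enc_sequent' (X \<turnstile> Y) = Nd (enc_nat 0) (Nd (enc X) (enc Y))"
| "enc_sequent' (X \<turnstile>\<^sub>M Y) = Nd (enc_nat 1) (Nd (enc X) (enc Y))"
definition enc_sequent_inst: "enc = enc_sequent'"
instance
proof
  show "enc S = enc S' \<longleftrightarrow> S = S'" for S S' :: "'a sequent"
    unfolding enc_sequent_inst by (cases S; cases S') auto
qed
end

lemma enc_sequent_eq: "enc S = enc_sequent S"
  unfolding enc_sequent_inst by (cases S) simp_all

lemma polytime_comp4:
  assumes "polytime (\<lambda>z. k (fst z) (fst (snd z)) (fst (snd (snd z))) (snd (snd (snd z))))"
    "polytime f" "polytime g" "polytime h" "polytime l"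
  shows "polytime (\<lambda>x. k (f x) (g x) (h x) (l x))"
  using polytime_comp[OF assms(1)
      polytime_Pair[OF assms(2) polytime_Pair[OF assms(3) polytime_Pair[OF assms(4,5)]]]] by simp

text \<open>The number is the constructor tag of the encoding, so tuple and formula are the same
  tree. The constructors below are treated alike.\<close>

lemma polytime_Neg [polytime_intros]: "polytime f \<Longrightarrow> polytime (\<lambda>x. Neg (f x))"
  by (rule polytime_cong[where f = "\<lambda>x. (3 :: nat, f x)"]) (intro polytime_intros, assumption, simp)

lemma polytime_Con [polytime_intros]:
  "polytime f \<Longrightarrow> polytime g \<Longrightarrow> polytime (\<lambda>x. Con (f x) (g x))"
  by (rule polytime_cong[where f = "\<lambda>x. (4 :: nat, f x, g x)"]) (intro polytime_intros, assumption+, simp)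

lemma polytime_Dis [polytime_intros]:
  "polytime f \<Longrightarrow> polytime g \<Longrightarrow> polytime (\<lambda>x. Dis (f x) (g x))"
  by (rule polytime_cong[where f = "\<lambda>x. (5 :: nat, f x, g x)"]) (intro polytime_intros, assumption+, simp)

lemma polytime_Imp [polytime_intros]:
  "polytime f \<Longrightarrow> polytime g \<Longrightarrow> polytime (\<lambda>x. Imp (f x) (g x))"
  by (rule polytime_cong[where f = "\<lambda>x. (6 :: nat, f x, g x)"]) (intro polytime_intros, assumption+, simp)

lemma polytime_T [polytime_intros]: "polytime f \<Longrightarrow> polytime (\<lambda>x. T (f x))"
  by (rule polytime_cong[where f = "\<lambda>x. (0 :: nat, f x)"]) (intro polytime_intros, assumption, simp)

lemma polytime_F [polytime_intros]: "polytime f \<Longrightarrow> polytime (\<lambda>x. F (f x))"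
  by (rule polytime_cong[where f = "\<lambda>x. (1 :: nat, f x)"]) (intro polytime_intros, assumption, simp)

lemma polytime_Classical [polytime_intros]:
  "polytime f \<Longrightarrow> polytime g \<Longrightarrow> polytime (\<lambda>x. f x \<turnstile> g x)"
  by (rule polytime_cong[where f = "\<lambda>x. (0 :: nat, f x, g x)"])
    (intro polytime_intros, assumption+, simp add: enc_sequent_inst)

lemma polytime_Minimal [polytime_intros]:
  "polytime f \<Longrightarrow> polytime g \<Longrightarrow> polytime (\<lambda>x. f x \<turnstile>\<^sub>M g x)"
  by (rule polytime_cong[where f = "\<lambda>x. (1 :: nat, f x, g x)"])
    (intro polytime_intros, assumption+, simp add: enc_sequent_inst)

lemma polytime_form [polytime_intros]:
  assumes "polytime f"
  shows "polytime (\<lambda>x. form (f x))"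
proof (rule polytime_cong[OF polytime_dsnd[OF assms]])
  show "enc (dsnd (enc (f x))) = enc (form (f x))" for x by (cases "f x") auto
qed

text \<open>Atoms have tag 0, the only tag whose unary code is a leaf.\<close>

lemma polytime_is_atom [polytime_intros]:
  assumes "polytime f"
  shows "polytime (\<lambda>x. is_atom (f x))"
proof -
  have "is_atom A \<longleftrightarrow> dfst (enc A) = Lf" for A by (cases A) (auto simp: is_atom_def numeral_eq_Suc)
  then show ?thesis by (simp only:) (intro polytime_intros polytime_dfst assms)
qed

lemma polytime_strip [polytime_intros]:
  assumes "polytime f"
  shows "polytime (\<lambda>x. strip (f x))"
proof (rule polytime_cong)
  show "polytime (\<lambda>x. if dfst (enc (f x)) = enc (3 :: nat) then dsnd (enc (f x)) else enc (f x))"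
    by (intro polytime_intros polytime_dfst polytime_dsnd polytime_enc assms)
  show "enc (if dfst (enc (f x)) = enc (3 :: nat) then dsnd (enc (f x)) else enc (f x)) = enc (strip (f x))" for x
    by (cases "f x") (auto simp: numeral_eq_Suc)
qed

lemma polytime_opp [polytime_intros]:
  assumes "polytime f"
  shows "polytime (\<lambda>x. opp (f x))"
proof -
  have "opp s = (if s = T (form s) then F (form s) else T (form s))" for s by (cases s) auto
  then show ?thesis by (simp only:) (intro polytime_intros assms)
qed

lemma polytime_prefixes [polytime_intros]: "polytime f \<Longrightarrow> polytime (\<lambda>x. prefixes (f x))"
  unfolding prefixes_conv_suffixes by (intro polytime_intros)

lemma polytime_imp_chain [polytime_intros]:
  assumes "polytime f" "polytime g"
  shows "polytime (\<lambda>x. imp_chain (f x) (g x))"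
proof -
  have "polytime (\<lambda>x. foldl (\<lambda>A b. Imp b A) (Neg (g x)) (rev (f x)))"
  proof (rule polytime_foldl)
    \<comment> \<open>An implication exceeds its parts by 15: two inner nodes and the unary tag 6 of
      size 13. The factor 20 per list cell is a generous bound.\<close>
    have size: "esize (foldl (\<lambda>A b. Imp b A) C ys) \<le> esize C + 20 * esize ys" for C ys
      by (induction ys arbitrary: C) (fastforce simp: numeral_eq_Suc intro: order.trans)+
    show "poly_bounded (\<lambda>x. esize (Neg (g x)) + 20 * esize (f x))"
      by (intro poly_bounded_intros polytime_esize polytime_intros assms)
    show "esize (foldl (\<lambda>A b. Imp b A) (Neg (g x)) ys) \<le> esize (Neg (g x)) + 20 * esize (f x)"
      if "rev (f x) = ys @ zs" for x ys zs
    proof -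
      have "esize ys \<le> esize (f x)"
        using that esize_append[of ys zs] esize_rev[of "f x"] dsize_pos[of "enc zs"] by simp
      then show ?thesis using size[of "Neg (g x)" ys] by simp
    qed
  qed (intro polytime_intros assms)+
  then show ?thesis by (simp add: imp_chain_def foldr_conv_foldl)
qed

text \<open>From here on each definition is a combination of operations already treated, so
  unfolding it and applying the closure rules suffices.\<close>

lemma polytime_seq [polytime_intros]: "polytime f \<Longrightarrow> polytime (\<lambda>x. seq (f x))"
  by (rule polytime_comp[of seq]) (unfold seq_def, intro polytime_intros)

lemma polytime_weakenings [polytime_intros]:
  assumes "polytime f" "polytime g"
  shows "polytime (\<lambda>x. weakenings (f x) (g x))"
  by (rule polytime_comp2[where h = weakenings, OF _ assms]) (unfold weakenings_def, intro polytime_intros)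

lemma polytime_templates [polytime_intros]:
  assumes "polytime f" "polytime g"
  shows "polytime (\<lambda>x. templates (f x) (g x))"
  by (rule polytime_comp2[where h = templates, OF _ assms]) (unfold templates_def, intro polytime_intros)

lemma polytime_all_templates [polytime_intros]: "polytime f \<Longrightarrow> polytime (\<lambda>x. all_templates (f x))"
  by (rule polytime_comp[of all_templates]) (unfold all_templates_def, intro polytime_intros)

lemma polytime_grid [polytime_intros]:
  assumes "polytime f" "polytime g" "polytime h"
  shows "polytime (\<lambda>x. grid (f x) (g x) (h x))"
  by (rule polytime_comp3[where k = grid, OF _ assms]) (unfold grid_def, intro polytime_intros)

lemma polytime_cuts [polytime_intros]:
  assumes "polytime f" "polytime g" "polytime h"
  shows "polytime (\<lambda>x. cuts (f x) (g x) (h x))"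
  by (rule polytime_comp3[where k = cuts, OF _ assms]) (unfold cuts_def, intro polytime_intros)

lemma polytime_all_cuts [polytime_intros]:
  assumes "polytime f" "polytime g"
  shows "polytime (\<lambda>x. all_cuts (f x) (g x))"
  by (rule polytime_comp2[where h = all_cuts, OF _ assms]) (unfold all_cuts_def, intro polytime_intros)

lemma polytime_discharge [polytime_intros]:
  assumes "polytime f" "polytime g" "polytime h" "polytime l"
  shows "polytime (\<lambda>x. discharge (f x) (g x) (h x) (l x))"
  by (rule polytime_comp4[where k = discharge, OF _ assms]) (unfold discharge_def, intro polytime_intros)

lemma polytime_discharges [polytime_intros]:
  assumes "polytime f" "polytime g" "polytime h"
  shows "polytime (\<lambda>x. discharges (f x) (g x) (h x))"
  by (rule polytime_comp3[where k = discharges, OF _ assms]) (unfold discharges_def, intro polytime_intros)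

lemma polytime_true_forms [polytime_intros]: "polytime f \<Longrightarrow> polytime (\<lambda>x. true_forms (f x))"
  by (rule polytime_comp[of true_forms]) (unfold true_forms_def, intro polytime_intros)

lemma polytime_true_atoms [polytime_intros]: "polytime f \<Longrightarrow> polytime (\<lambda>x. true_atoms (f x))"
  by (rule polytime_comp[of true_atoms]) (unfold true_atoms_def, intro polytime_intros)

lemma polytime_false_atoms [polytime_intros]: "polytime f \<Longrightarrow> polytime (\<lambda>x. false_atoms (f x))"
  by (rule polytime_comp[of false_atoms]) (unfold false_atoms_def, intro polytime_intros)

lemma polytime_saturated [polytime_intros]:
  assumes "polytime f" "polytime g"
  shows "polytime (\<lambda>x. saturated (f x) (g x))"
  by (rule polytime_comp2[where h = saturated, OF _ assms]) (unfold saturated_def, intro polytime_intros)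

lemma polytime_model_part [polytime_intros]:
  assumes "polytime f" "polytime g" "polytime h" "polytime l"
  shows "polytime (\<lambda>x. model_part (f x) (g x) (h x) (l x))"
  by (rule polytime_comp4[where k = model_part, OF _ assms]) (unfold model_part_def, intro polytime_intros)

lemma polytime_chain_step [polytime_intros]:
  assumes "polytime f" "polytime g"
  shows "polytime (\<lambda>x. chain_step (f x) (g x))"
  by (rule polytime_comp2[where h = chain_step, OF _ assms]) (unfold chain_step_def, intro polytime_intros)

lemma polytime_chain_part [polytime_intros]:
  assumes "polytime f" "polytime g"
  shows "polytime (\<lambda>x. chain_part (f x) (g x))"
  by (rule polytime_comp2[where h = chain_part, OF _ assms]) (unfold chain_part_def, intro polytime_intros)

lemma polytime_chain_bases [polytime_intros]:
  assumes "polytime f" "polytime g"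
  shows "polytime (\<lambda>x. chain_bases (f x) (g x))"
  by (rule polytime_comp2[where h = chain_bases, OF _ assms]) (unfold chain_bases_def, intro polytime_intros)

lemma polytime_node_part [polytime_intros]:
  assumes "polytime f" "polytime g" "polytime h"
  shows "polytime (\<lambda>x. node_part (f x) (g x) (h x))"
  by (rule polytime_comp3[where k = node_part, OF _ assms]) (unfold node_part_def, intro polytime_intros)

lemma polytime_universe [polytime_intros]: "polytime f \<Longrightarrow> polytime (\<lambda>x. universe (f x))"
  by (rule polytime_comp[of universe]) (unfold universe_def, intro polytime_intros)

lemma polytime_models [polytime_intros]: "polytime f \<Longrightarrow> polytime (\<lambda>x. models (f x))"
  by (rule polytime_comp[of models]) (unfold models_def, intro polytime_intros)

lemma polytime_candidates [polytime_intros]: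
  assumes "polytime f" "polytime g"
  shows "polytime (\<lambda>x. candidates (f x) (g x))"
  by (rule polytime_comp2[where h = candidates, OF _ assms]) (unfold candidates_def, intro polytime_intros)

lemma polytime_exclusions [polytime_intros]: "polytime f \<Longrightarrow> polytime (\<lambda>x. exclusions (f x))"
  by (rule polytime_comp[of exclusions]) (unfold exclusions_def, intro polytime_intros)

lemma polytime_lemma_forms [polytime_intros]: "polytime f \<Longrightarrow> polytime (\<lambda>x. lemma_forms (f x))"
  by (rule polytime_comp[of lemma_forms]) (unfold lemma_forms_def, intro polytime_intros)

lemma polytime_closing [polytime_intros]: "polytime f \<Longrightarrow> polytime (\<lambda>x. closing (f x))"
  by (rule polytime_comp[of closing]) (unfold closing_def, intro polytime_intros)

lemma polytime_derivation [polytime_intros]: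
  assumes "polytime f" "polytime g" "polytime h"
  shows "polytime (\<lambda>x. derivation (f x) (g x) (h x))"
  by (rule polytime_comp3[where k = derivation, OF _ assms]) (unfold derivation_def, intro polytime_intros)

section \<open>Traversing the tableau\<close>

text \<open>Selectors made total by default values; callers distinguish the constructors by the
  tests for \<open>End\<close> and \<open>is_ExtA\<close>, which can be read off the
  encoding.\<close>

primrec label1 :: "tableau \<Rightarrow> signed" where
  "label1 End = T Bot"
| "label1 (ExtA i s1 s2 t) = s1"
| "label1 (ExtB i s1 t1 s2 t2) = s1"

primrec label2 :: "tableau \<Rightarrow> signed" where
  "label2 End = T Bot"
| "label2 (ExtA i s1 s2 t) = s2"
| "label2 (ExtB i s1 t1 s2 t2) = s2"

primrec child1 :: "tableau \<Rightarrow> tableau" where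
  "child1 End = End"
| "child1 (ExtA i s1 s2 t) = t"
| "child1 (ExtB i s1 t1 s2 t2) = t1"

text \<open>The value at \<open>ExtA\<close> is what the encoding has at the position of the second
  subtree of \<open>ExtB\<close>, so one access path computes both cases.\<close>

primrec child2 :: "tableau \<Rightarrow> tableau" where
  "child2 End = End"
| "child2 (ExtA i s1 s2 t) = t"
| "child2 (ExtB i s1 t1 s2 t2) = t2"

definition is_ExtA :: "tableau \<Rightarrow> bool" where
  "is_ExtA t \<longleftrightarrow> (\<exists>i s1 s2 t'. t = ExtA i s1 s2 t')"

definition children :: "signed list \<times> tableau \<Rightarrow> (signed list \<times> tableau) list" where
  "children n = (if snd n = End then []
     else if is_ExtA (snd n) then [(fst n @ [label1 (snd n), label2 (snd n)], child1 (snd n))]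
     else [(fst n @ [label1 (snd n)], child1 (snd n)), (fst n @ [label2 (snd n)], child2 (snd n))])"

definition cut_labels :: "tableau \<Rightarrow> signed list" where
  "cut_labels t = (if t = End then [] else if is_ExtA t then [opp (label2 t), label1 t]
     else [label2 t, opp (label1 t)])"

text \<open>The recursion of \<open>nodes\<close> as a loop: one step pops a subtree from a stack
  and records its root. Recording in front reverses the preorder, which puts children before parents
  and the second subtree before the first.\<close>

definition visit :: "(signed list \<times> tableau) list \<times> (signed list \<times> signed list) list
    \<Rightarrow> (signed list \<times> tableau) list \<times> (signed list \<times> signed list) list" where
  "visit s = (case fst s of [] \<Rightarrow> s
     | n # ns \<Rightarrow> (children n @ ns, (fst n, cut_labels (snd n)) # snd s))"

lemma polytime_is_ExtA [polytime_intros]: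
  assumes "polytime f"
  shows "polytime (\<lambda>x. is_ExtA (f x))"
proof -
  have "is_ExtA t \<longleftrightarrow> enc t \<noteq> Lf \<and> dfst (enc t) = Lf" for t
    by (cases t) (auto simp: is_ExtA_def)
  then show ?thesis by (simp only:) (intro polytime_intros polytime_dfst polytime_enc assms)
qed

lemma polytime_label1 [polytime_intros]:
  assumes "polytime f"
  shows "polytime (\<lambda>x. label1 (f x))"
proof (rule polytime_cong)
  let ?s = "\<lambda>x. dsnd (dsnd (enc (f x)))"
  let ?g = "\<lambda>x. if f x = End then enc (T Bot) else if is_ExtA (f x) then dfst (?s x) else dfst (dfst (?s x))"
  show "polytime ?g"
    by (intro polytime_intros polytime_enc polytime_dfst_data polytime_dsnd_data polytime_dsnd assms)
  show "enc (?g x) = enc (label1 (f x))" for x by (cases "f x") (auto simp: is_ExtA_def)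
qed

lemma polytime_label2 [polytime_intros]:
  assumes "polytime f"
  shows "polytime (\<lambda>x. label2 (f x))"
proof (rule polytime_cong)
  let ?s = "\<lambda>x. dsnd (dsnd (enc (f x)))"
  let ?g = "\<lambda>x. if f x = End then enc (T Bot) else if is_ExtA (f x) then dfst (dsnd (?s x)) else dfst (dsnd (?s x))"
  show "polytime ?g"
    by (intro polytime_intros polytime_enc polytime_dfst_data polytime_dsnd_data polytime_dsnd assms)
  show "enc (?g x) = enc (label2 (f x))" for x by (cases "f x") (auto simp: is_ExtA_def)
qed

lemma polytime_child1 [polytime_intros]:
  assumes "polytime f"
  shows "polytime (\<lambda>x. child1 (f x))"
proof (rule polytime_cong)
  let ?s = "\<lambda>x. dsnd (dsnd (enc (f x)))"
  let ?g = "\<lambda>x. if f x = End then Lf else if is_ExtA (f x) then dsnd (dsnd (?s x)) else dsnd (dfst (?s x))"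
  show "polytime ?g"
    by (intro polytime_intros polytime_enc polytime_dfst_data polytime_dsnd_data polytime_dsnd assms)
  show "enc (?g x) = enc (child1 (f x))" for x by (cases "f x") (auto simp: is_ExtA_def)
qed

lemma polytime_child2 [polytime_intros]:
  assumes "polytime f"
  shows "polytime (\<lambda>x. child2 (f x))"
proof (rule polytime_cong)
  let ?s = "\<lambda>x. dsnd (dsnd (enc (f x)))"
  let ?g = "\<lambda>x. if f x = End then Lf else dsnd (dsnd (?s x))"
  show "polytime ?g"
    by (intro polytime_intros polytime_enc polytime_dfst_data polytime_dsnd_data polytime_dsnd assms)
  show "enc (?g x) = enc (child2 (f x))" for x by (cases "f x") (auto simp: is_ExtA_def)
qed

lemma polytime_visit: "polytime visit"
  unfolding visit_def children_def cut_labels_def by (intro polytime_intros)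

primrec node_count :: "tableau \<Rightarrow> nat" where
  "node_count End = 1"
| "node_count (ExtA i s1 s2 t) = 1 + node_count t"
| "node_count (ExtB i s1 t1 s2 t2) = 1 + node_count t1 + node_count t2"

text \<open>The loop variant: each visit handles exactly one node.\<close>

definition pending :: "(signed list \<times> tableau) list \<Rightarrow> nat" where
  "pending ns = sum_list (map (\<lambda>n. node_count (snd n)) ns)"

text \<open>The loop invariant: what the output will be once the stack has been emptied.\<close>

definition visit_result :: "(signed list \<times> tableau) list \<times> (signed list \<times> signed list) list
    \<Rightarrow> (signed list \<times> signed list) list" where
  "visit_result s = concat (rev (map (\<lambda>n. nodes (fst n) (snd n)) (fst s))) @ snd s"

text \<open>Labels only move from the subtree to the path leading to it, so the sum of the two sizes
  never exceeds its initial value \<open>K\<close>. An output entry adds at most two labels to a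
  path, with a few units for list cells and changed signs; \<open>2 * K + 10\<close> is a generous
  bound.\<close>

definition visit_bounded :: "nat \<Rightarrow> (signed list \<times> tableau) list \<times> (signed list \<times> signed list) list \<Rightarrow> bool" where
  "visit_bounded K s \<longleftrightarrow> (\<forall>n \<in> set (fst s). esize (fst n) + esize (snd n) \<le> K) \<and>
     (\<forall>n \<in> set (snd s). esize n \<le> 2 * K + 10)"

lemma node_count_le: "node_count t \<le> esize t"
  by (induction t) auto

lemma length_le_pending: "length ns \<le> pending ns"
proof (induction ns)
  case (Cons n ns)
  have "1 \<le> node_count (snd n)" by (cases "snd n") auto
  with Cons show ?case by (simp add: pending_def)
qed (simp add: pending_def)

lemma esize_opp: "esize (opp s) \<le> esize s + 2"
  by (cases s) auto

lemma visit_step: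
  assumes "fst s \<noteq> []"
  shows "Suc (pending (fst (visit s))) = pending (fst s)" "visit_result (visit s) = visit_result s"
    "length (snd (visit s)) = Suc (length (snd s))" "visit_bounded K s \<Longrightarrow> visit_bounded K (visit s)"
proof -
  obtain L t ns acc where s: "s = ((L, t) # ns, acc)"
    using assms by (cases s; cases "fst s") auto
  show "Suc (pending (fst (visit s))) = pending (fst s)" "visit_result (visit s) = visit_result s"
    "length (snd (visit s)) = Suc (length (snd s))"
    unfolding s by (cases t; simp add: visit_def children_def cut_labels_def is_ExtA_def
        pending_def visit_result_def)+
  assume bounded: "visit_bounded K s"
  then have K: "esize L + esize t \<le> K" unfolding s visit_bounded_def by simp
  have "esize (fst n) + esize (snd n) \<le> K" if "n \<in> set (children (L, t))" for n
    using that K esize_append[of L "[label1 t]"] esize_append[of L "[label2 t]"]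
      esize_append[of L "[label1 t, label2 t]"]
    by (cases t) (auto simp: children_def is_ExtA_def)
  moreover have "esize (L, cut_labels t) \<le> 2 * K + 10"
    using K esize_opp[of "label1 t"] esize_opp[of "label2 t"]
    by (cases t) (auto simp: cut_labels_def is_ExtA_def)
  ultimately show "visit_bounded K (visit s)"
    using bounded unfolding s visit_bounded_def by (auto simp: visit_def)
qed

lemma polytime_nodes [polytime_intros]:
  assumes "polytime f" "polytime g"
  shows "polytime (\<lambda>x. nodes (f x) (g x))"
proof (rule polytime_comp2[where h = nodes, OF _ assms])
  define init :: "signed list \<times> tableau \<Rightarrow> (signed list \<times> tableau) list \<times> (signed list \<times> signed list) list"
    where "init = (\<lambda>z. ([z], []))"
  define N where "N = (\<lambda>z :: signed list \<times> tableau. node_count (snd z))"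
  have N: "N z \<le> esize z" for z
    using node_count_le[of "snd z"] by (cases z) (simp add: N_def)
  have inv: "pending (fst ((visit ^^ i) (init z))) = N z - i \<and>
      visit_result ((visit ^^ i) (init z)) = nodes (fst z) (snd z) \<and>
      length (snd ((visit ^^ i) (init z))) = i \<and>
      visit_bounded (esize z) ((visit ^^ i) (init z))" if "i \<le> N z" for i z
    using that
  proof (induction i)
    case 0
    then show ?case
      by (cases z) (simp add: init_def pending_def N_def visit_result_def visit_bounded_def)
  next
    case (Suc i)
    let ?s = "(visit ^^ i) (init z)"
    have IH: "pending (fst ?s) = N z - i" "visit_result ?s = nodes (fst z) (snd z)"
      "length (snd ?s) = i" "visit_bounded (esize z) ?s"
      using Suc by auto
    then have "fst ?s \<noteq> []" using Suc.prems by (auto simp: pending_def)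
    from visit_step[OF this] IH show ?case by auto
  qed
  have "polytime (\<lambda>z. (visit ^^ N z) (init z))"
  proof (rule polytime_While)
    show "polytime init" unfolding init_def by (intro polytime_intros)
    show "polytime (\<lambda>s :: (signed list \<times> tableau) list \<times> (signed list \<times> signed list) list. fst s \<noteq> [])"
      by (intro polytime_intros)
    show "polytime visit" by (rule polytime_visit)
    show "poly_bounded N"
      by (rule poly_bounded_le[OF poly_bounded_esize N])
    show "fst ((visit ^^ i) (init z)) \<noteq> []" if "i < N z" for i z
      using inv[of i z] that by (auto simp: pending_def)
    show "\<not> fst ((visit ^^ N z) (init z)) \<noteq> []" for z
      using inv[of "N z" z] length_le_pending[of "fst ((visit ^^ N z) (init z))"] by simp
    \<comment> \<open>One unit for the pair, then \<open>esize_list_le\<close> twice, for at most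
      \<open>esize z\<close> entries: on the stack of size at most \<open>1 + esize z\<close>, in
      the output of size at most \<open>2 * esize z + 10\<close>.\<close>
    let ?h = "\<lambda>z :: signed list \<times> tableau. 1 + (1 + esize z * (2 + esize z)) + (1 + esize z * (11 + (esize z + esize z)))"
    show "poly_bounded ?h" by (intro poly_bounded_intros)
    show "esize ((visit ^^ i) (init z)) \<le> ?h z" if i: "i \<le> N z" for i z
    proof -
      let ?s = "(visit ^^ i) (init z)"
      have len: "length (fst ?s) \<le> esize z" "length (snd ?s) \<le> esize z"
        using inv[OF i] length_le_pending[of "fst ?s"] N[of z] i by auto
      have "esize (fst ?s) \<le> Suc (length (fst ?s) * Suc (Suc (esize z)))"
      proof (rule esize_list_le)
        fix n assume "n \<in> set (fst ?s)"
        then have "esize (fst n) + esize (snd n) \<le> esize z"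
          using inv[OF i] unfolding visit_bounded_def by blast
        then show "esize n \<le> Suc (esize z)" by (cases n) simp
      qed
      also have "\<dots> \<le> 1 + esize z * (2 + esize z)"
        using mult_le_mono1[OF len(1), of "Suc (Suc (esize z))"] by simp
      finally have 1: "esize (fst ?s) \<le> 1 + esize z * (2 + esize z)" .
      have "esize (snd ?s) \<le> Suc (length (snd ?s) * Suc (2 * esize z + 10))"
        using inv[OF i] unfolding visit_bounded_def by (intro esize_list_le) blast
      also have "\<dots> \<le> 1 + esize z * (11 + (esize z + esize z))"
        using mult_le_mono1[OF len(2), of "Suc (2 * esize z + 10)"] by simp
      finally have 2: "esize (snd ?s) \<le> 1 + esize z * (11 + (esize z + esize z))" .
      have "esize ?s = 1 + esize (fst ?s) + esize (snd ?s)" by simp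
      with 1 2 show ?thesis by linarith
    qed
  qed
  then have "polytime (\<lambda>z. snd ((visit ^^ N z) (init z)))" by (intro polytime_intros)
  moreover have "snd ((visit ^^ N z) (init z)) = nodes (fst z) (snd z)" for z
    using inv[of "N z" z] length_le_pending[of "fst ((visit ^^ N z) (init z))"]
    by (simp add: visit_result_def)
  ultimately show "polytime (\<lambda>z. nodes (fst z) (snd z))" by simp
qed

section \<open>The simulation\<close>

text \<open>The argument type is chosen so that its encoding is literally the tree of an
  \<open>OTAB\<close> proof; the number is the slot of the sequent tag.\<close>

definition translate :: "(nat \<times> fm list \<times> fm list) \<times> tableau \<Rightarrow> fm list sequent list" where
  "translate z = derivation (fst (snd (fst z))) (snd (snd (fst z)))
     (nodes (map T (fst (snd (fst z))) @ map F (snd (snd (fst z)))) (snd z))"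

theorem theorem3:
  fixes single :: bool
  shows "p_simulates (MLK single) OTAB"
proof -
  have "polytime translate" unfolding translate_def by (intro polytime_intros)
  then obtain c \<tau> where c: "\<And>z. \<exists>t \<le> \<tau> z. run c (enc z) (enc (translate z)) t" and "poly_bounded \<tau>"
    by (rule polytimeE) blast
  then obtain q :: "nat poly" where q: "\<And>z. \<tau> z \<le> poly q (esize z)"
    unfolding poly_bounded_def by blast
  show ?thesis
    unfolding p_simulates_def
  proof (intro exI[of _ c] exI[of _ q] allI impI)
    fix \<pi> \<phi> assume "OTAB \<pi> \<phi>"
    then obtain X Y t where pi: "\<pi> = Nd (enc_sequent (X \<turnstile>\<^sub>M Y)) (enc_tableau t)"
      and phi: "\<phi> = enc_sequent (X \<turnstile>\<^sub>M Y)" and otab: "otab_proof X Y t"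
      unfolding OTAB_def by blast
    \<comment> \<open>1 is the tag of a minimal-entailment sequent.\<close>
    define z where "z = ((1 :: nat, X, Y), t)"
    have z: "enc z = \<pi>" unfolding z_def pi by simp
    define d where "d = translate z"
    have d: "d = derivation X Y (nodes (map fst (initial_branch X Y)) t)"
      unfolding d_def translate_def z_def initial_branch_def by (simp add: comp_def)
    \<comment> \<open>The derivation uses \<open>M_left\<close> only with a single formula, so it is
      valid for either value of \<open>single\<close>.\<close>
    have "mlk_derivation single d"
      unfolding d
      by (rule mlk_derivation_single[OF mlk_derivation_if_derives[OF derives_derivation[OF otab refl]]])
    then have "MLK single (enc_list enc_sequent d) \<phi>"
      using last_derivation[of X Y] unfolding MLK_def phi d by blast
    moreover have "enc (translate z) = enc_list enc_sequent d"
      unfolding d_def using enc_sequent_eq by (simp add: ext[of enc enc_sequent])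
    moreover obtain t where "t \<le> \<tau> z" and run: "run c (enc z) (enc (translate z)) t"
      using c by blast
    then have "t \<le> poly q (dsize \<pi>)" using q[of z] unfolding z by (meson le_trans)
    ultimately show "\<exists>\<pi>' t. run c \<pi> \<pi>' t \<and> t \<le> poly q (dsize \<pi>) \<and> MLK single \<pi>' \<phi>"
      using run z by auto
  qed
qed

end
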